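(* Let $\{S_i\}_{i=1}^N$ be an IFS of contractive similitudes on $\mathbb R^d$ with contraction ratios $r_i\in(0,1)$ and self-similar set $K$, let $(X,\mathcal E)$ be its augmented tree, $(X^\sim,\mathcal E)$ the quotient space of the augmented tree and $(X^\sim,\mathcal E_v^* )$ the reduced tree. (1) Suppose $(X,\mathcal E)$ is simple and its incidence matrix $A$ is $(B,\mathbf u)$-rearrangeable, where $B$ is the incidence matrix of the tree $(X,\mathcal E_v)$ and $\mathbf u$ is the representation of the classes of horizontal components of $X$ by the classes of vertices of $(X,\mathcal E_v)$. Then $K$ is Lipschitz equivalent to a dust-like self-similar set with the same contraction ratios $r_1,\dots,r_N$ as for $K$. (2) Suppose $(X^\sim,\mathcal E)$ is simple and its incidence matrix $A$ is $(B,\mathbf u)$-rearrangeable, where $B$ is the incidence matrix of the reduced tree $(X^\sim,\mathcal E_v^* )$ and $\mathbf u$ is the representation of the classes of horizontal components of $X^\sim$ by the classes of vertices of $(X^\sim,\mathcal E_v^* )$. Then $K$ is Lipschitz equivalent to a Cantor-type set (not necessarily a dust-like self-similar set).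
   Context: **Self-similar sets.** The self-similar set $K$ of an IFS $\{S_i\}_{i=1}^N$ of contractive similitudes is the unique non-empty compact set with $K=\bigcup_{i=1}^N S_i(K)$. It is dust-like if $S_i(K)\cap S_j(K)=\emptyset$ for $i\ne j$. A Cantor-type set is a totally disconnected compact metric space. Metric spaces are Lipschitz equivalent if there is a bi-Lipschitz bijection between them. **Augmented tree.** Let $\Sigma=\{1,\dots,N\}$ and let $\Sigma^*$ be the set of finite words over $\Sigma$, including the empty word $\vartheta$. For $x=i_1\cdots i_k\in\Sigma^*$ put $S_x=S_{i_1}\circ\cdots\circ S_{i_k}$ and $r_x=r_{i_1}\cdots r_{i_k}$. Let $r=\min_i r_i$, $X_0=\{\vartheta\}$, $X_n=\{x=i_1\cdots i_k\in\Sigma^*: r_x\le r^n<r_{i_1}\cdots r_{i_{k-1}}\}$ for $n\ge1$, and $X=\bigcup_{n\ge0}X_n$. If $x\in X_n$ write $|x|=n$. For each $y\in X_n$, $n\ge1$, there is a unique prefix $x\in X_{n-1}$ of $y$, its parent; $\mathcal E_v$ is the (symmetric) set of edges joining a vertex to its parent. Fix $\kappa>0$ and let $\mathcal E_h=\{(x,y): |x|=|y|,\ x\ne y,\ \mathrm{dist}(S_x(K),S_y(K))\le\kappa r^{|x|}\}$, $\mathcal E=\mathcal E_v\cup\mathcal E_h$. The graph $(X,\mathcal E)$ with root $\vartheta$ is the augmented tree; $(X,\mathcal E_v)$ is a tree. **Quotient space and reduced tree.** $X^\sim$ is the quotient of $X$ by the relation identifying $x,y$ when $|x|=|y|$ and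 $S_x=S_y$. It carries the induced edges, still denoted $\mathcal E_v,\mathcal E_h,\mathcal E=\mathcal E_v\cup\mathcal E_h$: two distinct classes are joined by a vertical (resp. horizontal) edge if some representatives are. A vertex of $X^\sim$ may have several parents. The reduced tree $(X^\sim,\mathcal E_v^* )$ is obtained by keeping, for each non-root vertex $y\in X^\sim$ with parents $x_1<x_2<\dots<x_k$ in lexicographical order of finite words (comparing, say, the smallest representing words), only the vertical edge $(x_1,y)$ and removing all other vertical edges from $y$ to its parents. **Simple; incidence matrices.** Let $Z$ be $X$ or $X^\sim$. A horizontal component of $Z$ is a maximal subset $T$ of some level connected with respect to $\mathcal E_h$; $\mathcal F$ is the set of all of them. $T_{\mathcal D}$ is the union of $T$ and all its descendants, with the edges of $\mathcal E$ restricted to it. $T\sim T'$ if there is a graph isomorphism $T_{\mathcal D}\to T'_{\mathcal D}$ that, together with its inverse, preserves vertical edges (as parent–child relations) and horizontal edges. $(Z,\mathcal E)$ is simple if $\mathcal F/\!\sim$ is finite; then, with classes $[T_1],\dots,[T_m]$, its incidence matrix is $A=[a_{ij}]_{m\times m}$, $a_{ij}$ being the number of horizontal components consisting of offspring of $T\in[T_i]$ that belong to $[T_j]$. Let the tree be $(X,\mathcal E_v)$ if $Z=X$ and $(X^\sim,\mathcal E_v^* )$ if $Z=X^\sim$. Two of its vertices $x,y$ are equivalent if the subtrees formed by $x$ and its descendants and by $y$ and its descendants are isomorphic (preserving the parent–child relation); the tree is simple if there are finitely many classes $[\mathbf t_1],\dots,[\mathbf t_n]$, ordered with $\vartheta\in[\mathbf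 t_1]$, and its incidence matrix is $B=[b_{ij}]_{n\times n}$, $b_{ij}$ being the number of offspring in the tree of a vertex in $[\mathbf t_i]$ that belong to $[\mathbf t_j]$. For $T\in[T_i]$ let $u_{ij}$ be the number of vertices of $T$ in $[\mathbf t_j]$, $\mathbf u_i=[u_{i1},\dots,u_{in}]$, $\mathbf u=[\mathbf u_1,\dots,\mathbf u_m]$. (If $(X,\mathcal E)$ is simple then so is $(X,\mathcal E_v)$; for $X^\sim$ the use of $B$ and $\mathbf u$ presupposes that the reduced tree is simple and that $\mathbf u_i$ depends only on $[T_i]$.) **Rearrangeable.** Let $B$ be an $n\times n$ nonnegative integer matrix with rows $\mathbf b_1,\dots,\mathbf b_n$, and $\mathbf u=[\mathbf u_1,\dots,\mathbf u_m]$ with $\mathbf u_i=[u_{i1},\dots,u_{in}]$ a vector of nonnegative integers. An $m\times m$ matrix $A$ with rows $\mathbf a_1,\dots,\mathbf a_m$ is $(B,\mathbf u)$-rearrangeable if for each $i$ there is a nonnegative integer matrix $C=[c_{sj}]_{p\times m}$, $p=\sum_{j=1}^n u_{ij}$, such that $\mathbf a_i=\mathbf 1C$ (i.e. $\mathbf a_i$ is the sum of the rows of $C$) and, putting $\mathbf c_s=\sum_{j=1}^m c_{sj}\mathbf u_j$ for $1\le s\le p$, the list $\mathbf c_1,\dots,\mathbf c_p$ consists of exactly $u_{ij}$ terms assigned the value $\mathbf b_j$ for each $j=1,\dots,n$ (condition: $\#\{\mathbf c_k:\mathbf c_k=\mathbf b_j,\ k=1,\dots,p\}=u_{ij}$).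 *)

theory Defs
  imports
    "HOL-Analysis.Analysis"
    "HOL-Library.Sublist"
    "HOL-Library.List_Lexorder"
begin

text \<open>
  Similitudes, self-similar sets and Lipschitz equivalence are stated for the library's bundled metric spaces, so that they
  apply both to a Euclidean space given as a type (\<open>euclidean_metric\<close>) and to \<open>\<real>\<^sup>n\<close> for a
  natural number \<open>n\<close> that is itself quantified over (\<open>euclidean_n_metric n\<close> below).
\<close>

definition contractive_similitude :: "'a metric \<Rightarrow> real \<Rightarrow> ('a \<Rightarrow> 'a) \<Rightarrow> bool" where
  "contractive_similitude m c f \<longleftrightarrow>
     0 < c \<and> c < 1 \<and> f \<in> mspace m \<rightarrow> mspace m \<and>
     (\<forall>x\<in>mspace m. \<forall>y\<in>mspace m. mdist m (f x) (f y) = c * mdist m x y)"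

definition similitude_ifs :: "'a metric \<Rightarrow> nat \<Rightarrow> (nat \<Rightarrow> real) \<Rightarrow> (nat \<Rightarrow> 'a \<Rightarrow> 'a) \<Rightarrow> bool" where
  "similitude_ifs m N \<rho> S \<longleftrightarrow> 1 \<le> N \<and> (\<forall>i\<in>{1..N}. contractive_similitude m (\<rho> i) (S i))"

definition self_similar_set :: "'a metric \<Rightarrow> nat \<Rightarrow> (nat \<Rightarrow> 'a \<Rightarrow> 'a) \<Rightarrow> 'a set \<Rightarrow> bool" where
  "self_similar_set m N S K \<longleftrightarrow>
     K \<noteq> {} \<and> compactin (mtopology_of m) K \<and> K = (\<Union>i\<in>{1..N}. S i ` K)"

definition dust_like :: "nat \<Rightarrow> (nat \<Rightarrow> 'a \<Rightarrow> 'a) \<Rightarrow> 'a set \<Rightarrow> bool" where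
  "dust_like N S K \<longleftrightarrow> (\<forall>i\<in>{1..N}. \<forall>j\<in>{1..N}. i \<noteq> j \<longrightarrow> S i ` K \<inter> S j ` K = {})"

definition lipschitz_equivalent :: "'a metric \<Rightarrow> 'b metric \<Rightarrow> bool" where
  "lipschitz_equivalent m m' \<longleftrightarrow>
     (\<exists>f c C. 0 < c \<and> 0 < C \<and> bij_betw f (mspace m) (mspace m') \<and>
        (\<forall>x\<in>mspace m. \<forall>y\<in>mspace m.
           c * mdist m x y \<le> mdist m' (f x) (f y) \<and> mdist m' (f x) (f y) \<le> C * mdist m x y))"

definition totally_disconnected_space :: "'a topology \<Rightarrow> bool" where
  "totally_disconnected_space X \<longleftrightarrow> (\<forall>U. connectedin X U \<longrightarrow> (\<exists>a. U \<subseteq> {a}))"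

definition cantor_type :: "'a metric \<Rightarrow> bool" where
  "cantor_type m \<longleftrightarrow>
     compact_space (mtopology_of m) \<and> totally_disconnected_space (mtopology_of m)"

text \<open>
  The carrier is that of the library's topological space \<open>Euclidean_space n\<close>: the sequences
  vanishing from index \<open>n\<close> on.  The metric space instance on \<open>nat \<Rightarrow> real\<close> is not the Euclidean one.
\<close>

definition euclidean_n_metric :: "nat \<Rightarrow> (nat \<Rightarrow> real) metric" where
  "euclidean_n_metric n =
     metric (topspace (Euclidean_space n), \<lambda>x y. L2_set (\<lambda>i. x i - y i) {..<n})"

lemma Metric_space_euclidean_n:
  "Metric_space (topspace (Euclidean_space n)) (\<lambda>x y. L2_set (\<lambda>i. x i - y i) {..<n})"
proof
  fix x y z :: "nat \<Rightarrow> real"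
  show "0 \<le> L2_set (\<lambda>i. x i - y i) {..<n}"
    by (rule L2_set_nonneg)
  show "L2_set (\<lambda>i. x i - y i) {..<n} = L2_set (\<lambda>i. y i - x i) {..<n}"
    by (simp add: L2_set_def power2_commute)
  show "L2_set (\<lambda>i. x i - y i) {..<n} = 0 \<longleftrightarrow> x = y"
    if "x \<in> topspace (Euclidean_space n)" "y \<in> topspace (Euclidean_space n)"
  proof -
    have "x i = y i" if "i \<ge> n" for i
      using that \<open>x \<in> _\<close> \<open>y \<in> _\<close> by (simp add: topspace_Euclidean_space)
    then show ?thesis
      by (auto simp: L2_set_eq_0_iff fun_eq_iff) (metis lessThan_iff not_less)
  qed
  show "L2_set (\<lambda>i. x i - z i) {..<n} \<le>
        L2_set (\<lambda>i. x i - y i) {..<n} + L2_set (\<lambda>i. y i - z i) {..<n}"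
    using L2_set_triangle_ineq[of "\<lambda>i. x i - y i" "\<lambda>i. y i - z i" "{..<n}"] by simp
qed

lemma mspace_euclidean_n_metric [simp]:
  "mspace (euclidean_n_metric n) = topspace (Euclidean_space n)"
  unfolding euclidean_n_metric_def
  by (rule Metric_space.mspace_metric[OF Metric_space_euclidean_n])

lemma mdist_euclidean_n_metric [simp]:
  "mdist (euclidean_n_metric n) x y = L2_set (\<lambda>i. x i - y i) {..<n}"
  unfolding euclidean_n_metric_def
  by (simp add: Metric_space.mdist_metric[OF Metric_space_euclidean_n])

primrec word_map :: "(nat \<Rightarrow> 'a \<Rightarrow> 'a) \<Rightarrow> nat list \<Rightarrow> 'a \<Rightarrow> 'a" where
  "word_map S [] = id"
| "word_map S (i # x) = S i \<circ> word_map S x"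

definition word_ratio :: "(nat \<Rightarrow> real) \<Rightarrow> nat list \<Rightarrow> real" where
  "word_ratio \<rho> x = prod_list (map \<rho> x)"

definition min_ratio :: "nat \<Rightarrow> (nat \<Rightarrow> real) \<Rightarrow> real" where
  "min_ratio N \<rho> = Min (\<rho> ` {1..N})"

definition word_level :: "nat \<Rightarrow> (nat \<Rightarrow> real) \<Rightarrow> nat \<Rightarrow> nat list set" where
  "word_level N \<rho> n =
     (if n = 0 then {[]}
      else {x \<in> lists {1..N}. x \<noteq> [] \<and> word_ratio \<rho> x \<le> min_ratio N \<rho> ^ n \<and>
              min_ratio N \<rho> ^ n < word_ratio \<rho> (butlast x)})"

text \<open>
  Vertical edges are stored as pairs \<open>(parent, child)\<close>; the symmetric edge set is the union of
  \<open>vert\<close> and its converse.  Horizontal edges are stored in both directions.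
\<close>

record 'v level_graph =
  level :: "nat \<Rightarrow> 'v set"
  vert :: "('v \<times> 'v) set"
  horiz :: "('v \<times> 'v) set"

definition vertices :: "'v level_graph \<Rightarrow> 'v set" where
  "vertices Z = (\<Union>n. level Z n)"

definition augmented_tree ::
  "nat \<Rightarrow> (nat \<Rightarrow> real) \<Rightarrow> (nat \<Rightarrow> 'a::metric_space \<Rightarrow> 'a) \<Rightarrow> 'a set \<Rightarrow> real \<Rightarrow> nat list level_graph"
where
  "augmented_tree N \<rho> S K \<kappa> =
     \<lparr> level = word_level N \<rho>,
       vert = {(x, y). \<exists>n. x \<in> word_level N \<rho> n \<and> y \<in> word_level N \<rho> (Suc n) \<and> prefix x y},
       horiz = {(x, y). \<exists>n. x \<in> word_level N \<rho> n \<and> y \<in> word_level N \<rho> n \<and> x \<noteq> y \<and>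
                  setdist (word_map S x ` K) (word_map S y ` K) \<le> \<kappa> * min_ratio N \<rho> ^ n} \<rparr>"

definition quotient_tree ::
  "nat \<Rightarrow> (nat \<Rightarrow> real) \<Rightarrow> (nat \<Rightarrow> 'a::metric_space \<Rightarrow> 'a) \<Rightarrow> 'a set \<Rightarrow> real \<Rightarrow> nat list set level_graph"
where
  "quotient_tree N \<rho> S K \<kappa> =
    (let X = augmented_tree N \<rho> S K \<kappa>;
         L = (\<lambda>n. level X n // {(x, y). x \<in> level X n \<and> y \<in> level X n \<and> word_map S x = word_map S y});
         V = (\<Union>n. L n)
     in \<lparr> level = L,
          vert = {(a, b). a \<in> V \<and> b \<in> V \<and> a \<noteq> b \<and> (\<exists>x\<in>a. \<exists>y\<in>b. (x, y) \<in> vert X)},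
          horiz = {(a, b). a \<in> V \<and> b \<in> V \<and> a \<noteq> b \<and> (\<exists>x\<in>a. \<exists>y\<in>b. (x, y) \<in> horiz X)} \<rparr>)"

text \<open>
  Here \<open>\<le>\<close> and \<open>Min\<close> on words refer to the lexicographic order of \<open>List_Lexorder\<close>; the classes are
  finite and \<open>Min a\<close> is the smallest word representing the class \<open>a\<close>.
\<close>

definition reduced_vert :: "nat list set level_graph \<Rightarrow> (nat list set \<times> nat list set) set" where
  "reduced_vert Z = {(a, c). (a, c) \<in> vert Z \<and> (\<forall>b. (b, c) \<in> vert Z \<longrightarrow> Min a \<le> Min b)}"

definition rel_preserving :: "('v \<times> 'v) set \<Rightarrow> 'v set \<Rightarrow> ('v \<Rightarrow> 'v) \<Rightarrow> bool" where
  "rel_preserving R D \<phi> \<longleftrightarrow> (\<forall>x\<in>D. \<forall>y\<in>D. (x, y) \<in> R \<longleftrightarrow> (\<phi> x, \<phi> y) \<in> R)"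

definition horizontally_connected :: "'v level_graph \<Rightarrow> 'v set \<Rightarrow> bool" where
  "horizontally_connected Z T \<longleftrightarrow> T \<noteq> {} \<and> (\<forall>x\<in>T. \<forall>y\<in>T. (x, y) \<in> (horiz Z \<inter> T \<times> T)\<^sup>*)"

definition horizontal_components :: "'v level_graph \<Rightarrow> 'v set set" where
  "horizontal_components Z =
     {T. \<exists>n. T \<subseteq> level Z n \<and> horizontally_connected Z T \<and>
           (\<forall>T'. T \<subseteq> T' \<and> T' \<subseteq> level Z n \<and> horizontally_connected Z T' \<longrightarrow> T' = T)}"

definition component_equiv :: "'v level_graph \<Rightarrow> 'v set \<Rightarrow> 'v set \<Rightarrow> bool" where
  "component_equiv Z T T' \<longleftrightarrow>
     (\<exists>\<phi>. bij_betw \<phi> ((vert Z)\<^sup>* `` T) ((vert Z)\<^sup>* `` T') \<and>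
          rel_preserving (vert Z) ((vert Z)\<^sup>* `` T) \<phi> \<and>
          rel_preserving (horiz Z) ((vert Z)\<^sup>* `` T) \<phi>)"

definition component_classes :: "'v level_graph \<Rightarrow> 'v set set set" where
  "component_classes Z = horizontal_components Z //
     {(T, T'). T \<in> horizontal_components Z \<and> T' \<in> horizontal_components Z \<and> component_equiv Z T T'}"

definition simple_graph :: "'v level_graph \<Rightarrow> bool" where
  "simple_graph Z \<longleftrightarrow> finite (component_classes Z)"

definition subtree_equiv :: "('v \<times> 'v) set \<Rightarrow> 'v \<Rightarrow> 'v \<Rightarrow> bool" where
  "subtree_equiv E x y \<longleftrightarrow>
     (\<exists>\<phi>. bij_betw \<phi> (E\<^sup>* `` {x}) (E\<^sup>* `` {y}) \<and> rel_preserving E (E\<^sup>* `` {x}) \<phi>)"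

definition vertex_classes :: "'v set \<Rightarrow> ('v \<times> 'v) set \<Rightarrow> 'v set set" where
  "vertex_classes V E = V // {(x, y). x \<in> V \<and> y \<in> V \<and> subtree_equiv E x y}"

text \<open>
  Matrices are functions of indices starting at 1, of which only the values within the stated
  dimensions matter.  In the following definitions \<open>\<tau> 1, \<dots>, \<tau> m\<close> and \<open>\<sigma> 1, \<dots>, \<sigma> n\<close> are the
  classes of horizontal components and of tree vertices.  Each entry is required to have the given
  value for every representative of the class, so these predicates include the
  independence of the choice of representative.
\<close>

definition is_component_incidence ::
  "'v level_graph \<Rightarrow> nat \<Rightarrow> (nat \<Rightarrow> 'v set set) \<Rightarrow> (nat \<Rightarrow> nat \<Rightarrow> nat) \<Rightarrow> bool" where
  "is_component_incidence Z m \<tau> A \<longleftrightarrow>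
     (\<forall>i\<in>{1..m}. \<forall>j\<in>{1..m}. \<forall>T\<in>\<tau> i. A i j = card {T' \<in> \<tau> j. T' \<subseteq> vert Z `` T})"

definition is_tree_incidence ::
  "('v \<times> 'v) set \<Rightarrow> nat \<Rightarrow> (nat \<Rightarrow> 'v set) \<Rightarrow> (nat \<Rightarrow> nat \<Rightarrow> nat) \<Rightarrow> bool" where
  "is_tree_incidence E n \<sigma> B \<longleftrightarrow>
     (\<forall>i\<in>{1..n}. \<forall>j\<in>{1..n}. \<forall>x\<in>\<sigma> i. B i j = card {y \<in> \<sigma> j. (x, y) \<in> E})"

definition is_representation ::
  "nat \<Rightarrow> (nat \<Rightarrow> 'v set set) \<Rightarrow> nat \<Rightarrow> (nat \<Rightarrow> 'v set) \<Rightarrow> (nat \<Rightarrow> nat \<Rightarrow> nat) \<Rightarrow> bool" where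
  "is_representation m \<tau> n \<sigma> u \<longleftrightarrow>
     (\<forall>i\<in>{1..m}. \<forall>j\<in>{1..n}. \<forall>T\<in>\<tau> i. u i j = card (T \<inter> \<sigma> j))"

definition rearrangeable ::
  "nat \<Rightarrow> nat \<Rightarrow> (nat \<Rightarrow> nat \<Rightarrow> nat) \<Rightarrow> (nat \<Rightarrow> nat \<Rightarrow> nat) \<Rightarrow> (nat \<Rightarrow> nat \<Rightarrow> nat) \<Rightarrow> bool" where
  "rearrangeable m n B u A \<longleftrightarrow>
     (\<forall>i\<in>{1..m}. \<exists>C :: nat \<Rightarrow> nat \<Rightarrow> nat.
        let p = (\<Sum>j=1..n. u i j); c = (\<lambda>s k. \<Sum>j=1..m. C s j * u j k) in
        (\<forall>j\<in>{1..m}. A i j = (\<Sum>s=1..p. C s j)) \<and>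
        (\<forall>j\<in>{1..n}. card {s \<in> {1..p}. \<forall>k\<in>{1..n}. c s k = B j k} = u i j))"

end

theory Submission
  imports Defs
begin

text \<open>
  Infinite words over \<open>{1..N}\<close> are the ends of the tree of words.  Give two ends that first differ after the
  common prefix \<open>x\<close> the distance \<open>r\<^sub>x\<close>.  Call a map from the ends onto a metric space a coding if it changes
  this distance at most by constant factors.  Two spaces that have codings are Lipschitz equivalent
  (\<open>lipschitz_equivalent_of_codings\<close>), so the first statement follows once \<open>K\<close> and some dust-like set both
  have codings.

  A dust-like set with the given ratios exists for every choice of ratios, but in general not one made of homothetic
  copies inside a convex body, because two copies scaled by more than one half always meet.  In the model used here each
  map of \<open>\<real>\<^sup>k\<close> scales by its ratio, shifts the coordinates cyclically and adds its index to coordinate 0.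
  A coordinate is then scaled \<open>k\<close> times before another index is added to it, so for large \<open>k\<close>
  the index can be read off from coordinate 0 and the natural address map is a coding (\<open>dust_coding\<close>).

  For \<open>K\<close>, let the body of a horizontal component \<open>T\<close> be the union of the sets \<open>S\<^sub>x(K)\<close>, \<open>x \<in> T\<close>.  The components
  have bounded size because there are finitely many classes.  Hence at level \<open>n\<close> the bodies have diameter
  \<open>O(r\<^sup>n)\<close>, while by maximality different bodies are more than \<open>\<kappa> r\<^sup>n\<close> apart.  Thus \<open>K\<close> is, up to Lipschitz
  equivalence, the boundary of the tree of components (\<open>bodies_small\<close>, \<open>bodies_apart\<close>).  It remains to match this
  boundary with that of the tree of words.  Rearrangeability supplies the matching: level by level one
  assigns to each component \<open>T\<close> a set \<open>G(T)\<close> of words of that level, containing as many words of each class as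
  \<open>T\<close> does, so that the sets \<open>G(T)\<close> partition the level and the set of every offspring component of
  \<open>T\<close> consists of offspring of one single word in \<open>G(T)\<close> (\<open>grouping_step\<close>).  Along a nested sequence of
  components these common parents form a path in the tree, hence an end; conversely an end
  determines the components.  Components that separate at level \<open>n\<close> have words that separate at level
  \<open>n - 1\<close> or \<open>n\<close>, so the resulting map is a coding of \<open>K\<close> (\<open>grouping_coding\<close>).

  The rearrangement condition counts, for each class \<open>j\<close>, the groups whose sum is the row \<open>b\<^sub>j\<close>.  These groups can
  be handed out to the words of class \<open>j\<close> without conflict only if different classes have different rows.  They
  do, since a vertex with the same number of offspring in each class spans an isomorphic subtree
  (\<open>subtree_equiv_of_equal_offspring\<close>).

  For the second statement the same estimates apply to the quotient graph, since equivalent words have the same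
  cell.  The bodies of one level are finitely many disjoint closed sets of diameter \<open>O(r\<^sup>n)\<close> covering \<open>K\<close>, so \<open>K\<close>
  is totally disconnected and is itself the required Cantor-type set.
\<close>

section \<open>Distributing finite sets with prescribed fibres\<close>

text \<open>
  Realise a prescribed list of sizes by the fibres of a map: enumerate \<open>J\<close> by the
  disjoint union of intervals of these sizes.
\<close>
lemma distribute:
  assumes "finite I" "finite J" "(\<Sum>i\<in>I. f i) = card J"
  shows "\<exists>h. h \<in> J \<rightarrow> I \<and> (\<forall>i\<in>I. card {j \<in> J. h j = i} = f i)"
proof -
  let ?P = "SIGMA i:I. {..<f i}"
  have "card J = card ?P" using assms by (simp add: card_SigmaI)
  then obtain b where b: "bij_betw b J ?P"
    using finite_same_card_bij[of J ?P] assms(1,2) by auto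
  have "card {j \<in> J. fst (b j) = i} = f i" if i: "i \<in> I" for i
  proof -
    have "bij_betw b {j \<in> J. fst (b j) = i} ({i} \<times> {..<f i})"
      unfolding bij_betw_def
    proof
      show "inj_on b {j \<in> J. fst (b j) = i}"
        using b unfolding bij_betw_def inj_on_def by blast
      have "b ` {j \<in> J. fst (b j) = i} = {z \<in> b ` J. fst z = i}" by auto
      also have "b ` J = ?P" using b by (simp add: bij_betw_def)
      also have "{z \<in> ?P. fst z = i} = {i} \<times> {..<f i}" using i by auto
      finally show "b ` {j \<in> J. fst (b j) = i} = {i} \<times> {..<f i}" .
    qed
    from bij_betw_same_card[OF this] show ?thesis by simp
  qed
  moreover have "(\<lambda>j. fst (b j)) \<in> J \<rightarrow> I"
    using bij_betwE[OF b] by (intro Pi_I) (metis SigmaE fst_conv)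
  ultimately show ?thesis by (intro exI[of _ "\<lambda>j. fst (b j)"]) simp
qed

lemma distribute_typed:
  assumes "finite I" "finite J"
    and "\<And>k. k \<in> Q \<Longrightarrow> (\<Sum>i\<in>I. f i k) = card {j \<in> J. t j = k}"
    and t: "t \<in> J \<rightarrow> Q"
  shows "\<exists>h. h \<in> J \<rightarrow> I \<and> (\<forall>i\<in>I. \<forall>k\<in>Q. card {j \<in> J. t j = k \<and> h j = i} = f i k)"
proof -
  have "\<forall>k\<in>Q. \<exists>h. h \<in> {j \<in> J. t j = k} \<rightarrow> I \<and> (\<forall>i\<in>I. card {j \<in> {j \<in> J. t j = k}. h j = i} = f i k)"
    by (intro ballI distribute) (use assms(1-3) in simp_all)
  from bchoice[OF this] obtain h where
    H: "\<forall>k\<in>Q. h k \<in> {j \<in> J. t j = k} \<rightarrow> I \<and> (\<forall>i\<in>I. card {j \<in> {j \<in> J. t j = k}. h k j = i} = f i k)" ..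
  have h: "h k \<in> {j \<in> J. t j = k} \<rightarrow> I" if "k \<in> Q" for k
    using bspec[OF H that] by simp
  have c: "card {j \<in> {j \<in> J. t j = k}. h k j = i} = f i k" if "k \<in> Q" "i \<in> I" for k i
    using bspec[OF H that(1)] that(2) by simp
  have "(\<lambda>j. h (t j) j) \<in> J \<rightarrow> I"
    using h t by (simp add: Pi_iff)
  moreover have "card {j \<in> J. t j = k \<and> h (t j) j = i} = f i k" if "k \<in> Q" "i \<in> I" for k i
  proof -
    have "{j \<in> J. t j = k \<and> h (t j) j = i} = {j \<in> {j \<in> J. t j = k}. h k j = i}" by auto
    then show ?thesis using c that by simp
  qed
  ultimately show ?thesis by (intro exI[of _ "\<lambda>j. h (t j) j"]) simp
qed

text \<open>
  The combinatorial core of the level-by-level matching.  \<open>G\<close> is a set of tree vertices with the same class counts as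
  a component of class \<open>i\<close>, \<open>D\<close> is the set of offspring components of that component, and \<open>q\<close> distributes the
  offspring of \<open>G\<close> over \<open>D\<close>.  The rows of \<open>C\<close> split \<open>D\<close> into groups; since the rows of \<open>B\<close> are distinct, the
  groups can be matched bijectively with \<open>G\<close> so that the group of \<open>v\<close> contains in total as many vertices of each
  class as \<open>v\<close> has offspring.  The offspring of \<open>v\<close> are then distributed within the group of \<open>v\<close> only, which gives
  the last conclusion.
\<close>
lemma rearrangement_step:
  fixes u B :: "nat \<Rightarrow> nat \<Rightarrow> nat"
  assumes finG: "finite G" and finD: "finite D" and finc: "\<And>v. v \<in> G \<Longrightarrow> finite (ch v)"
    and par: "\<And>v y. v \<in> G \<Longrightarrow> y \<in> ch v \<Longrightarrow> par y = v"
    and tyG: "ty \<in> G \<rightarrow> {1..n}" and tyc: "\<And>v. v \<in> G \<Longrightarrow> ty \<in> ch v \<rightarrow> {1..n}"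
    and cty: "cty \<in> D \<rightarrow> {1..m}"
    and rows: "\<And>j j'. \<lbrakk>j \<in> {1..n}; j' \<in> {1..n}; \<forall>k\<in>{1..n}. B j k = B j' k\<rbrakk> \<Longrightarrow> j = j'"
    and R: "rearrangeable m n B u A" and i: "i \<in> {1..m}"
    and cG: "\<And>k. k \<in> {1..n} \<Longrightarrow> card {v \<in> G. ty v = k} = u i k"
    and cD: "\<And>j. j \<in> {1..m} \<Longrightarrow> card {d \<in> D. cty d = j} = A i j"
    and cB: "\<And>v k. v \<in> G \<Longrightarrow> k \<in> {1..n} \<Longrightarrow> card {y \<in> ch v. ty y = k} = B (ty v) k"
  obtains q where "\<And>y. y \<in> (\<Union>v\<in>G. ch v) \<Longrightarrow> q y \<in> D"
    and "\<And>d k. d \<in> D \<Longrightarrow> k \<in> {1..n} \<Longrightarrow>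
           card {y \<in> (\<Union>v\<in>G. ch v). ty y = k \<and> q y = d} = u (cty d) k"
    and "\<And>y y'. \<lbrakk>y \<in> (\<Union>v\<in>G. ch v); y' \<in> (\<Union>v\<in>G. ch v); q y = q y'\<rbrakk> \<Longrightarrow> par y = par y'"
proof -
  define p where "p = (\<Sum>j=1..n. u i j)"
  have "\<exists>C :: nat \<Rightarrow> nat \<Rightarrow> nat. (\<forall>j\<in>{1..m}. A i j = (\<Sum>s=1..p. C s j)) \<and>
     (\<forall>j\<in>{1..n}. card {s \<in> {1..p}. \<forall>k\<in>{1..n}. (\<Sum>j'=1..m. C s j' * u j' k) = B j k} = u i j)"
    using bspec[OF R[unfolded rearrangeable_def Let_def] i] unfolding p_def .
  then obtain C :: "nat \<Rightarrow> nat \<Rightarrow> nat" where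
    C: "(\<forall>j\<in>{1..m}. A i j = (\<Sum>s=1..p. C s j)) \<and>
      (\<forall>j\<in>{1..n}. card {s \<in> {1..p}. \<forall>k\<in>{1..n}. (\<Sum>j'=1..m. C s j' * u j' k) = B j k} = u i j)" ..
  define P where "P j = {s \<in> {1..p}. \<forall>k\<in>{1..n}. (\<Sum>j'=1..m. C s j' * u j' k) = B j k}" for j
  \<comment> \<open>The map \<open>g\<close> sends each offspring component to the number of its group.\<close>
  have "\<exists>g. g \<in> D \<rightarrow> {1..p} \<and> (\<forall>s\<in>{1..p}. \<forall>j\<in>{1..m}. card {d \<in> D. cty d = j \<and> g d = s} = C s j)"
    by (rule distribute_typed) (use finD cty C cD in simp_all)
  then obtain g where gg: "g \<in> D \<rightarrow> {1..p} \<and>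
    (\<forall>s\<in>{1..p}. \<forall>j\<in>{1..m}. card {d \<in> D. cty d = j \<and> g d = s} = C s j)" ..
  then have g: "g \<in> D \<rightarrow> {1..p}" ..
  have gC: "card {d \<in> D. cty d = j \<and> g d = s} = C s j" if "s \<in> {1..p}" "j \<in> {1..m}" for s j
    using gg that by simp
  have "\<forall>j\<in>{1..n}. \<exists>e. bij_betw e {v \<in> G. ty v = j} (P j)"
    by (intro ballI finite_same_card_bij) (use C cG finG in \<open>simp_all add: P_def\<close>)
  from bchoice[OF this] obtain e where "\<forall>j\<in>{1..n}. bij_betw (e j) {v \<in> G. ty v = j} (P j)" ..
  then have e: "bij_betw (e j) {v \<in> G. ty v = j} (P j)" if "j \<in> {1..n}" for j
    using that by simp
  \<comment> \<open>The vertices of class \<open>j\<close> receive the groups that sum up to row \<open>j\<close> of \<open>B\<close>.  No group is received twice,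
    even by vertices of different classes, because the rows are distinct.\<close>
  define \<eta> where "\<eta> v = e (ty v) v" for v
  have \<eta>P: "\<eta> v \<in> P (ty v)" if "v \<in> G" for v
    using bij_betwE[OF e[of "ty v"]] that tyG unfolding \<eta>_def by blast
  have inj: "inj_on \<eta> G"
  proof (rule inj_onI)
    fix v v' assume v: "v \<in> G" "v' \<in> G" "\<eta> v = \<eta> v'"
    have "ty v = ty v'"
      using \<eta>P[OF v(1)] \<eta>P[OF v(2)] v tyG by (intro rows) (auto simp: P_def)
    moreover have "ty v \<in> {1..n}" using tyG v(1) by (simp add: Pi_iff)
    ultimately show "v = v'"
      using v inj_onD[OF bij_betw_imp_inj_on[OF e[of "ty v"]]] by (simp add: \<eta>_def)
  qed
  have "card G = card (\<Union>k\<in>{1..n}. {v \<in> G. ty v = k})" using tyG by (intro arg_cong[of _ _ card]) auto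
  also have "\<dots> = (\<Sum>k\<in>{1..n}. card {v \<in> G. ty v = k})" using finG by (intro card_UN_disjoint) auto
  also have "\<dots> = p" unfolding p_def using cG by (intro sum.cong) auto
  finally have cardG: "card G = p" .
  have "\<eta> ` G \<subseteq> {1..p}" using \<eta>P by (auto simp: P_def)
  then have surj: "\<eta> ` G = {1..p}" using cardG card_image[OF inj] by (intro card_subset_eq) auto
  have "\<forall>v\<in>G. \<exists>h. h \<in> ch v \<rightarrow> {d \<in> D. g d = \<eta> v} \<and>
     (\<forall>d\<in>{d \<in> D. g d = \<eta> v}. \<forall>k\<in>{1..n}. card {y \<in> ch v. ty y = k \<and> h y = d} = u (cty d) k)"
  proof (intro ballI distribute_typed)
    fix v k assume v: "v \<in> G" and k: "k \<in> {1..n}"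
    have s: "\<eta> v \<in> {1..p}" using surj v by auto
    have "(\<Sum>d\<in>{d \<in> D. g d = \<eta> v}. u (cty d) k)
        = (\<Sum>j\<in>{1..m}. \<Sum>d\<in>{d \<in> {d \<in> D. g d = \<eta> v}. cty d = j}. u (cty d) k)"
      using finD cty by (intro sum.group[symmetric]) auto
    also have "\<dots> = (\<Sum>j\<in>{1..m}. C (\<eta> v) j * u j k)"
    proof (intro sum.cong refl)
      fix j assume j: "j \<in> {1..m}"
      have "(\<Sum>d\<in>{d \<in> {d \<in> D. g d = \<eta> v}. cty d = j}. u (cty d) k)
          = (\<Sum>d\<in>{d \<in> D. cty d = j \<and> g d = \<eta> v}. u j k)" by (rule sum.cong) auto
      also have "\<dots> = card {d \<in> D. cty d = j \<and> g d = \<eta> v} * u j k" by simp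
      also have "card {d \<in> D. cty d = j \<and> g d = \<eta> v} = C (\<eta> v) j" by (rule gC[OF s j])
      finally show "(\<Sum>d\<in>{d \<in> {d \<in> D. g d = \<eta> v}. cty d = j}. u (cty d) k) = C (\<eta> v) j * u j k" .
    qed
    also have "\<dots> = B (ty v) k" using \<eta>P[OF v] k by (auto simp: P_def)
    finally show "(\<Sum>d\<in>{d \<in> D. g d = \<eta> v}. u (cty d) k) = card {y \<in> ch v. ty y = k}"
      using cB v k by simp
  qed (use finD finc tyc in auto)
  from bchoice[OF this] obtain h where H: "\<forall>v\<in>G. h v \<in> ch v \<rightarrow> {d \<in> D. g d = \<eta> v} \<and>
     (\<forall>d\<in>{d \<in> D. g d = \<eta> v}. \<forall>k\<in>{1..n}. card {y \<in> ch v. ty y = k \<and> h v y = d} = u (cty d) k)" ..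
  have h: "h v \<in> ch v \<rightarrow> {d \<in> D. g d = \<eta> v}" if "v \<in> G" for v
    using bspec[OF H that] ..
  have hc: "card {y \<in> ch v. ty y = k \<and> h v y = d} = u (cty d) k"
    if "v \<in> G" "d \<in> D" "g d = \<eta> v" "k \<in> {1..n}" for v d k
    using bspec[OF H that(1)] that by simp
  let ?q = "\<lambda>y. h (par y) y"
  have q: "?q y \<in> D \<and> g (?q y) = \<eta> v" if "v \<in> G" "y \<in> ch v" for v y
    using h[OF that(1)] that par[OF that] by (simp add: Pi_iff)
  show ?thesis
  proof
    show "?q y \<in> D" if "y \<in> (\<Union>v\<in>G. ch v)" for y using that q by blast
    show "par y = par y'"
      if "y \<in> (\<Union>v\<in>G. ch v)" "y' \<in> (\<Union>v\<in>G. ch v)" "?q y = ?q y'" for y y'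
    proof -
      from that obtain v v' where v: "v \<in> G" "y \<in> ch v" "v' \<in> G" "y' \<in> ch v'" by blast
      then have "\<eta> v = \<eta> v'" using q that(3) by metis
      then show ?thesis using v par inj by (auto simp: inj_on_def)
    qed
    show "card {y \<in> (\<Union>v\<in>G. ch v). ty y = k \<and> ?q y = d} = u (cty d) k"
      if d: "d \<in> D" and k: "k \<in> {1..n}" for d k
    proof -
      have "g d \<in> \<eta> ` G" using surj g d by auto
      then obtain v where v: "v \<in> G" "g d = \<eta> v" by auto
      have "{y \<in> (\<Union>v\<in>G. ch v). ty y = k \<and> ?q y = d} = {y \<in> ch v. ty y = k \<and> h v y = d}"
      proof (intro set_eqI iffI)
        fix y assume "y \<in> {y \<in> (\<Union>v\<in>G. ch v). ty y = k \<and> ?q y = d}"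
        then obtain v' where v': "v' \<in> G" "y \<in> ch v'" "ty y = k" "?q y = d" by blast
        then have "\<eta> v' = \<eta> v" using q v by metis
        then have "v' = v" using v v' inj by (auto simp: inj_on_def)
        then show "y \<in> {y \<in> ch v. ty y = k \<and> h v y = d}" using v' par by auto
      qed (use v par in auto)
      then show ?thesis using hc v d k by simp
    qed
  qed
qed

section \<open>Isomorphisms of subtrees\<close>

lemma rel_preserving_comp:
  assumes "bij_betw f D D'" "rel_preserving R D f" "rel_preserving R D' g"
  shows "rel_preserving R D (g \<circ> f)"
  using assms bij_betwE[OF assms(1)] unfolding rel_preserving_def by simp

lemma rel_preserving_inv:
  assumes f: "bij_betw f D D'" and R: "rel_preserving R D f"
  shows "rel_preserving R D' (inv_into D f)"
  unfolding rel_preserving_def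
proof (intro ballI)
  fix x y assume "x \<in> D'" "y \<in> D'"
  then show "(x, y) \<in> R \<longleftrightarrow> (inv_into D f x, inv_into D f y) \<in> R"
    using R bij_betw_inv_into_right[OF f] bij_betwE[OF bij_betw_inv_into[OF f]]
    unfolding rel_preserving_def by metis
qed

lemma equiv_subtree_equiv: "equiv V {(x, y). x \<in> V \<and> y \<in> V \<and> subtree_equiv E x y}"
proof (rule equivI)
  show "refl_on V {(x, y). x \<in> V \<and> y \<in> V \<and> subtree_equiv E x y}"
    by (auto simp: refl_on_def subtree_equiv_def rel_preserving_def intro!: exI[of _ id])
  show "sym {(x, y). x \<in> V \<and> y \<in> V \<and> subtree_equiv E x y}"
    unfolding sym_def subtree_equiv_def
    by (auto intro: bij_betw_inv_into rel_preserving_inv)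
  show "trans {(x, y). x \<in> V \<and> y \<in> V \<and> subtree_equiv E x y}"
    unfolding trans_def subtree_equiv_def
    by (auto intro: bij_betw_trans rel_preserving_comp)
qed auto

lemma equiv_component_equiv: "equiv F {(x, y). x \<in> F \<and> y \<in> F \<and> component_equiv Z x y}"
proof (rule equivI)
  show "refl_on F {(x, y). x \<in> F \<and> y \<in> F \<and> component_equiv Z x y}"
    by (auto simp: refl_on_def component_equiv_def rel_preserving_def intro!: exI[of _ id])
  show "sym {(x, y). x \<in> F \<and> y \<in> F \<and> component_equiv Z x y}"
    unfolding sym_def component_equiv_def
    by (auto intro: bij_betw_inv_into rel_preserving_inv)
  show "trans {(x, y). x \<in> F \<and> y \<in> F \<and> component_equiv Z x y}"
    unfolding trans_def component_equiv_def
    by (safe, metis bij_betw_trans rel_preserving_comp)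
qed auto

text \<open>
  An enumeration of the classes turns into an index function on the elements, which is easier to count with.
\<close>
lemma quotient_index:
  assumes R: "equiv V R" and b: "bij_betw s {1..n::nat} (V // R)"
  shows "\<exists>t. (\<forall>x\<in>V. t x \<in> {1..n}) \<and> (\<forall>j\<in>{1..n}. \<forall>x. x \<in> s j \<longleftrightarrow> x \<in> V \<and> t x = j)"
proof -
  define t where "t x = inv_into {1..n} s (R `` {x})" for x
  have q: "R `` {x} \<in> V // R" if "x \<in> V" for x using that by (rule quotientI)
  have t: "t x \<in> {1..n}" if "x \<in> V" for x
    unfolding t_def using bij_betwE[OF bij_betw_inv_into[OF b]] q[OF that] by blast
  have st: "s (t x) = R `` {x}" if "x \<in> V" for x
    unfolding t_def using bij_betw_inv_into_right[OF b] q[OF that] by blast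
  have "x \<in> s j \<longleftrightarrow> x \<in> V \<and> t x = j" if j: "j \<in> {1..n}" for x j
  proof
    have sj: "s j \<in> V // R" using b j bij_betwE by blast
    assume x: "x \<in> s j"
    then have xV: "x \<in> V" using sj R in_quotient_imp_subset by blast
    have "x \<in> R `` {x}" using R xV by (rule equiv_class_self)
    then have "s j = R `` {x}" using quotient_disj[OF R sj q[OF xV]] x by blast
    then have "s j = s (t x)" using st xV by simp
    then have "j = t x" using b j t[OF xV] by (meson bij_betw_def inj_onD)
    then show "x \<in> V \<and> t x = j" using xV by simp
  next
    assume "x \<in> V \<and> t x = j"
    then show "x \<in> s j" using st[of x] equiv_class_self[OF R] by auto
  qed
  then show ?thesis using t by (intro exI[of _ t]) simp
qed

text \<open>
  The root is the only vertex of a subtree without a parent in that subtree.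
\<close>
lemma subtree_root_preserved:
  assumes f: "bij_betw f (E\<^sup>* `` {x}) (E\<^sup>* `` {y})" and R: "rel_preserving E (E\<^sup>* `` {x}) f"
    and acyc: "\<And>z. (y, z) \<in> E\<^sup>* \<Longrightarrow> (z, y) \<notin> E"
  shows "f x = y"
proof -
  obtain z where z: "(x, z) \<in> E\<^sup>*" "f z = y"
  proof -
    have "y \<in> f ` E\<^sup>* `` {x}" using bij_betw_imp_surj_on[OF f] by simp
    then show ?thesis using that by auto
  qed
  have "z = x"
  proof (rule ccontr)
    assume "z \<noteq> x"
    then obtain w where w: "(x, w) \<in> E\<^sup>*" "(w, z) \<in> E" using z(1) by (auto elim: rtranclE)
    then have "(f w, y) \<in> E" using R z unfolding rel_preserving_def by auto
    moreover have "(y, f w) \<in> E\<^sup>*" using bij_betwE[OF f] w by auto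
    ultimately show False using acyc[of "f w"] by simp
  qed
  then show ?thesis using z by simp
qed

lemma rtrancl_level_le:
  assumes "(x, y) \<in> E\<^sup>*" "\<And>x y. (x, y) \<in> E \<Longrightarrow> lev y = Suc (lev x)"
  shows "lev x \<le> lev y"
  using assms(1)
proof induction
  case (step y z)
  then show ?case using assms(2)[of y z] by simp
qed simp

text \<open>
  Isomorphisms between the branches at \<open>x\<close> and those at \<open>y\<close> combine to an isomorphism of the whole subtrees.
\<close>
lemma subtree_equiv_glue:
  fixes lev :: "'v \<Rightarrow> nat"
  assumes lev: "\<And>x y. (x, y) \<in> E \<Longrightarrow> lev y = Suc (lev x)"
    and up: "\<And>x x' y. (x, y) \<in> E \<Longrightarrow> (x', y) \<in> E \<Longrightarrow> x = x'"
    and h: "bij_betw h (E `` {x}) (E `` {y})"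
    and iso: "\<And>c. (x, c) \<in> E \<Longrightarrow> subtree_equiv E c (h c)"
  shows "subtree_equiv E x y"
proof -
  let ?D = "\<lambda>c. E\<^sup>* `` {c}"
  obtain f where f: "\<And>c. (x, c) \<in> E \<Longrightarrow> bij_betw (f c) (?D c) (?D (h c))"
    and fR: "\<And>c. (x, c) \<in> E \<Longrightarrow> rel_preserving E (?D c) (f c)"
    using iso unfolding subtree_equiv_def by metis
  have le: "(a, b) \<in> E\<^sup>* \<Longrightarrow> lev a \<le> lev b" for a b using rtrancl_level_le lev by metis
  have noback: "(a, b) \<in> E\<^sup>* \<Longrightarrow> (b, a) \<notin> E" for a b using le lev by fastforce
  \<comment> \<open>Since parents are unique, the descendants of a vertex split into the vertex itself and the
    disjoint sets of descendants of its offspring.\<close>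
  have uniq: "c = c'" if "(a, c) \<in> E" "(a, c') \<in> E" "(c, z) \<in> E\<^sup>*" "(c', z) \<in> E\<^sup>*" for a c c' z
    using that(3,4)
  proof (induction rule: rtrancl_induct)
    case base
    show ?case
    proof (rule ccontr)
      assume "c \<noteq> c'"
      then have "(c', c) \<in> E\<^sup>+" using base by (metis rtranclD)
      then obtain w where "(c', w) \<in> E\<^sup>*" "(w, c) \<in> E" by (meson tranclD2)
      moreover have "w = a" using up[OF _ that(1)] \<open>(w, c) \<in> E\<close> by simp
      ultimately show False using noback[of c' a] that(2) by simp
    qed
  next
    case (step w z)
    show ?case
    proof (cases "z = c'")
      case True
      then have "w = a" using up[OF step(2)] that(2) by simp
      then show ?thesis using noback[of c a] step(1) that(1) by simp
    next
      case False
      then obtain w' where w': "(c', w') \<in> E\<^sup>*" "(w', z) \<in> E" using step(4) by (auto elim: rtranclE)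
      then have "w' = w" using up[OF _ step(2)] by simp
      then show ?thesis using step(3) w'(1) by simp
    qed
  qed
  have split: "?D a = insert a (\<Union>c\<in>E `` {a}. ?D c)" for a
    by (auto elim: converse_rtranclE intro: converse_rtrancl_into_rtrancl)
  have notin: "a \<notin> ?D c" if "(a, c) \<in> E" for a c using noback that by blast
  define ch where "ch z = (THE c. (x, c) \<in> E \<and> (c, z) \<in> E\<^sup>*)" for z
  have ch: "ch z = c" if "(x, c) \<in> E" "(c, z) \<in> E\<^sup>*" for c z
    unfolding ch_def using that uniq by blast
  define F where "F z = (if z = x then y else f (ch z) z)" for z
  have Fx: "F x = y" by (simp add: F_def)
  have Fc: "F z = f c z" if "(x, c) \<in> E" "(c, z) \<in> E\<^sup>*" for c z
    using that ch notin by (auto simp: F_def)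
  have hc: "(y, h c) \<in> E" if "(x, c) \<in> E" for c using bij_betwE[OF h] that by auto
  have FD: "(h c, F z) \<in> E\<^sup>*" if "(x, c) \<in> E" "(c, z) \<in> E\<^sup>*" for c z
    using bij_betwE[OF f[OF that(1)]] that Fc by auto
  have fc: "f c c = h c" if "(x, c) \<in> E" for c
    using f fR that noback by (intro subtree_root_preserved) auto
  have bij: "bij_betw F (?D x) (?D y)"
  proof -
    have im: "F ` ?D x = ?D y"
    proof -
      have "F ` (\<Union>c\<in>E `` {x}. ?D c) = (\<Union>c\<in>E `` {x}. f c ` ?D c)"
        unfolding image_UN by (intro SUP_cong refl image_cong) (auto simp: Fc)
      also have "\<dots> = (\<Union>c\<in>E `` {x}. ?D (h c))"
        using f by (intro SUP_cong refl) (auto simp: bij_betw_def)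
      also have "\<dots> = (\<Union>c\<in>h ` E `` {x}. ?D c)" by blast
      also have "\<dots> = (\<Union>c\<in>E `` {y}. ?D c)" using h by (simp add: bij_betw_def)
      finally show ?thesis using split[of x] split[of y] Fx by (metis image_insert)
    qed
    have "inj_on F (?D x)"
    proof (rule inj_onI)
      fix z z' assume z: "z \<in> ?D x" "z' \<in> ?D x" "F z = F z'"
      have *: "z = x \<or> (\<exists>c. (x, c) \<in> E \<and> (c, z) \<in> E\<^sup>*)"
        if "z \<in> ?D x" for z using that split[of x] by auto
      have ny: "F z \<noteq> y" if "(x, c) \<in> E" "(c, z) \<in> E\<^sup>*" for c z
        using FD[OF that] hc[OF that(1)] noback[of "h c" y] by auto
      show "z = z'"
      proof (cases "z = x \<or> z' = x")
        case True
        then show ?thesis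
        proof
          assume "z = x"
          then show ?thesis using *[OF z(2)] ny z(3) Fx by force
        next
          assume "z' = x"
          then show ?thesis using *[OF z(1)] ny z(3) Fx by force
        qed
      next
        case False
        then obtain c c' where c: "(x, c) \<in> E" "(c, z) \<in> E\<^sup>*" "(x, c') \<in> E" "(c', z') \<in> E\<^sup>*"
          using *[OF z(1)] *[OF z(2)] by auto
        have "(h c', F z) \<in> E\<^sup>*" using FD[OF c(3,4)] z(3) by simp
        then have "h c = h c'" using uniq[OF hc[OF c(1)] hc[OF c(3)] FD[OF c(1,2)]] by simp
        then have "c = c'" using inj_onD[OF bij_betw_imp_inj_on[OF h]] c by simp
        then show ?thesis
          using inj_onD[OF bij_betw_imp_inj_on[OF f[OF c(1)]], of z z'] c z(3)
            Fc[OF c(1,2)] Fc[OF c(3,4)] by simp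
      qed
    qed
    then show ?thesis using im by (simp add: bij_betw_def)
  qed
  have "rel_preserving E (?D x) F"
    unfolding rel_preserving_def
  proof (intro ballI)
    fix z z' assume z: "z \<in> ?D x" "z' \<in> ?D x"
    have Dy: "F z \<in> ?D y" "F z' \<in> ?D y" using bij_betwE[OF bij] z by auto
    show "(z, z') \<in> E \<longleftrightarrow> (F z, F z') \<in> E"
    proof (cases "z' = x")
      case True
      have "(z, x) \<notin> E" "(F z, y) \<notin> E" using noback z Dy by auto
      then show ?thesis using True Fx by simp
    next
      case z': False
      then obtain c' where c': "(x, c') \<in> E" "(c', z') \<in> E\<^sup>*" using z split[of x] by auto
      have root: "F z' = h c' \<longleftrightarrow> z' = c'"
      proof -
        have "F z' = f c' z'" "f c' c' = h c'" using Fc[OF c'] fc[OF c'(1)] by auto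
        then show ?thesis
          using inj_onD[OF bij_betw_imp_inj_on[OF f[OF c'(1)]], of z' c'] c' by auto
      qed
      \<comment> \<open>Both edge relations hold exactly for the unique parent: the root if the target is the top of
        its branch, a vertex of the same branch otherwise.\<close>
      have top: "(z, z') \<in> E \<longleftrightarrow> z = x" if "z' = c'"
        using that c'(1) up[of z c' x] by auto
      have top': "(F z, F z') \<in> E \<longleftrightarrow> F z = y" if "z' = c'"
        using that root hc[OF c'(1)] up[of "F z" "h c'" y] by auto
      have Fzx: "F z = y \<longleftrightarrow> z = x"
        using inj_onD[OF bij_betw_imp_inj_on[OF bij], of z x] z Fx by auto
      show ?thesis
      proof (cases "z' = c'")
        case True then show ?thesis using top top' Fzx by simp
      next
        case False
        have in_b: "(c', z) \<in> E\<^sup>*" if "(z, z') \<in> E"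
        proof -
          obtain w where "(c', w) \<in> E\<^sup>*" "(w, z') \<in> E" using c'(2) False by (auto elim: rtranclE)
          then show ?thesis using up[OF that, of w] by simp
        qed
        have in_b': "(h c', F z) \<in> E\<^sup>*" if "(F z, F z') \<in> E"
        proof -
          obtain w where "(h c', w) \<in> E\<^sup>*" "(w, F z') \<in> E"
            using FD[OF c'] False root by (auto elim: rtranclE)
          then show ?thesis using up[OF that, of w] by simp
        qed
        have branch: "(c', z) \<in> E\<^sup>*" if *: "(h c', F z) \<in> E\<^sup>*"
        proof -
          obtain z0 where z0: "(c', z0) \<in> E\<^sup>*" "f c' z0 = F z"
          proof -
            have "F z \<in> f c' ` E\<^sup>* `` {c'}" using bij_betw_imp_surj_on[OF f[OF c'(1)]] * by simp
            then show ?thesis using that by auto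
          qed
          then have "F z0 = F z" using Fc[OF c'(1)] by simp
          moreover have "z0 \<in> ?D x" using converse_rtrancl_into_rtrancl[OF c'(1) z0(1)] by simp
          ultimately have "z0 = z" using inj_onD[OF bij_betw_imp_inj_on[OF bij]] z(1) by simp
          then show ?thesis using z0 by simp
        qed
        have "(z, z') \<in> E \<longleftrightarrow> (F z, F z') \<in> E" if "(c', z) \<in> E\<^sup>*"
          using that fR[OF c'(1)] c'(2) Fc[OF c'(1) that] Fc[OF c']
          unfolding rel_preserving_def by simp
        then show ?thesis using in_b in_b' branch by blast
      qed
    qed
  qed
  then show ?thesis using bij unfolding subtree_equiv_def by blast
qed

text \<open>
  In terms of the incidence matrix: different classes of vertices have different rows.
\<close>
lemma subtree_equiv_of_equal_offspring:
  fixes lev :: "'v \<Rightarrow> nat"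
  assumes lev: "\<And>x y. (x, y) \<in> E \<Longrightarrow> lev y = Suc (lev x)"
    and up: "\<And>x x' y. (x, y) \<in> E \<Longrightarrow> (x', y) \<in> E \<Longrightarrow> x = x'"
    and fin: "finite (E `` {x})" "finite (E `` {y})"
    and t: "\<And>z. z \<in> E `` {x} \<union> E `` {y} \<Longrightarrow> t z \<in> Q"
    and eq: "\<And>z z'. \<lbrakk>z \<in> E `` {x}; z' \<in> E `` {y}; t z = t z'\<rbrakk> \<Longrightarrow> subtree_equiv E z z'"
    and card: "\<And>k. k \<in> Q \<Longrightarrow> card {z \<in> E `` {x}. t z = k} = card {z \<in> E `` {y}. t z = k}"
  shows "subtree_equiv E x y"
proof -
  have "\<forall>k\<in>Q. \<exists>h. bij_betw h {z \<in> E `` {x}. t z = k} {z \<in> E `` {y}. t z = k}"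
    by (intro ballI finite_same_card_bij finite_subset[OF _ fin(1)] finite_subset[OF _ fin(2)] card) auto
  from bchoice[OF this] obtain h where
    "\<forall>k\<in>Q. bij_betw (h k) {z \<in> E `` {x}. t z = k} {z \<in> E `` {y}. t z = k}" ..
  then have h: "bij_betw (h k) {z \<in> E `` {x}. t z = k} {z \<in> E `` {y}. t z = k}" if "k \<in> Q" for k
    using that by simp
  let ?h = "\<lambda>z. h (t z) z"
  have hin: "?h z \<in> E `` {y} \<and> t (?h z) = t z" if "z \<in> E `` {x}" for z
    using bij_betwE[OF h[OF t[of z]]] that by auto
  have "bij_betw ?h (E `` {x}) (E `` {y})"
    unfolding bij_betw_def
  proof
    show "inj_on ?h (E `` {x})"
    proof (rule inj_onI)
      fix z z' assume z: "z \<in> E `` {x}" "z' \<in> E `` {x}" "?h z = ?h z'"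
      then have "t z = t z'" using hin[OF z(1)] hin[OF z(2)] by simp
      then show "z = z'"
        using z inj_onD[OF bij_betw_imp_inj_on[OF h[OF t[of z]]], of z z'] by simp
    qed
    show "?h ` (E `` {x}) = E `` {y}"
    proof
      show "?h ` (E `` {x}) \<subseteq> E `` {y}" using hin by (simp add: image_subset_iff)
      show "E `` {y} \<subseteq> ?h ` (E `` {x})"
      proof
        fix z' assume z': "z' \<in> E `` {y}"
        then have "z' \<in> h (t z') ` {z \<in> E `` {x}. t z = t z'}"
          using bij_betw_imp_surj_on[OF h[OF t[of z']]] by simp
        then obtain w where "w \<in> E `` {x}" "t w = t z'" "z' = h (t z') w" by auto
        then show "z' \<in> ?h ` (E `` {x})" by (intro image_eqI[where x = w]) simp_all
      qed
    qed
  qed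
  moreover have "subtree_equiv E c (?h c)" if "(x, c) \<in> E" for c
    using that hin[of c] eq[of c "?h c"] by auto
  ultimately show ?thesis using subtree_equiv_glue[of E lev ?h x y] lev up by simp
qed

section \<open>Words, levels and ends of the tree\<close>

locale ratio_system =
  fixes N :: nat and \<rho> :: "nat \<Rightarrow> real"
  assumes N: "1 \<le> N" and ratio: "\<And>i. i \<in> {1..N} \<Longrightarrow> 0 < \<rho> i \<and> \<rho> i < 1"
begin

abbreviation r :: real where "r \<equiv> min_ratio N \<rho>"
abbreviation X :: "nat \<Rightarrow> nat list set" where "X \<equiv> word_level N \<rho>"
abbreviation ratio_of :: "nat list \<Rightarrow> real" where "ratio_of \<equiv> word_ratio \<rho>"
abbreviation W :: "nat list set" where "W \<equiv> lists {1..N}"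

lemma r_le: "i \<in> {1..N} \<Longrightarrow> r \<le> \<rho> i"
  unfolding min_ratio_def by (intro Min_le) auto

lemma r_bounds: "0 < r" "r < 1"
proof -
  have "r \<in> \<rho> ` {1..N}" unfolding min_ratio_def using N by (intro Min_in) auto
  then show "0 < r" "r < 1" using ratio by auto
qed

lemma max_ratio:
  obtains t where "0 < t" "t < 1" "\<And>i. i \<in> {1..N} \<Longrightarrow> \<rho> i \<le> t"
proof
  have "Max (\<rho> ` {1..N}) \<in> \<rho> ` {1..N}" using N by (intro Max_in) auto
  then show "0 < Max (\<rho> ` {1..N})" "Max (\<rho> ` {1..N}) < 1" using ratio by auto
qed auto

lemma ratio_Nil [simp]: "ratio_of [] = 1" by (simp add: word_ratio_def)
lemma ratio_Cons [simp]: "ratio_of (i # x) = \<rho> i * ratio_of x" by (simp add: word_ratio_def)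
lemma ratio_append: "ratio_of (x @ y) = ratio_of x * ratio_of y" by (simp add: word_ratio_def)

lemma ratio_pos: "x \<in> W \<Longrightarrow> 0 < ratio_of x"
  by (induction x) (use ratio in auto)

lemma ratio_le_power:
  assumes t: "\<And>i. i \<in> {1..N} \<Longrightarrow> \<rho> i \<le> t" and x: "x \<in> W"
  shows "ratio_of x \<le> t ^ length x"
  using x
proof (induction x)
  case (Cons i x)
  then show ?case
    using t[of i] ratio[of i] ratio_pos[of x] by (auto intro!: mult_mono)
qed simp

lemma ratio_le_1: "x \<in> W \<Longrightarrow> ratio_of x \<le> 1"
  using ratio_le_power[of 1 x] ratio by (simp add: less_imp_le)

lemma ratio_prefix_mono:
  assumes "prefix x y" "y \<in> W" shows "ratio_of y \<le> ratio_of x"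
proof -
  obtain z where y: "y = x @ z" using assms by (auto simp: prefix_def)
  then have "0 < ratio_of x" "ratio_of z \<le> 1" using assms ratio_pos ratio_le_1 by auto
  then show ?thesis by (simp add: y ratio_append mult_le_cancel_left1)
qed

lemma prefix_W: "prefix x y \<Longrightarrow> y \<in> W \<Longrightarrow> x \<in> W"
  by (auto simp: prefix_def)

lemma W_butlast: "x \<in> W \<Longrightarrow> butlast x \<in> W"
  by (meson in_listsD in_listsI in_set_butlastD)

text \<open>
  The minimality form of the definition, which treats level 0 like the others: the elements of a level are the
  words at which the ratio first drops to the bound.
\<close>
lemma mem_X_iff:
  "x \<in> X n \<longleftrightarrow> x \<in> W \<and> ratio_of x \<le> r ^ n \<and> (\<forall>z. strict_prefix z x \<longrightarrow> r ^ n < ratio_of z)"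
proof (cases "n = 0")
  case True
  have "x = []" if "\<forall>z. strict_prefix z x \<longrightarrow> 1 < ratio_of z"
  proof (rule ccontr)
    assume "x \<noteq> []"
    then have "strict_prefix [] x" by (simp add: strict_prefix_def)
    then show False using that by fastforce
  qed
  then show ?thesis using True by (auto simp: word_level_def)
next
  case False
  show ?thesis
  proof
    assume "x \<in> X n"
    then have x: "x \<in> W" "x \<noteq> []" "ratio_of x \<le> r ^ n" "r ^ n < ratio_of (butlast x)"
      using False by (auto simp: word_level_def)
    have "r ^ n < ratio_of z" if "strict_prefix z x" for z
    proof -
      have "x = butlast x @ [last x]" using x by simp
      then have "prefix z (butlast x)" using that by (metis prefix_snoc strict_prefix_def)
      then have "ratio_of (butlast x) \<le> ratio_of z" using x W_butlast by (intro ratio_prefix_mono) auto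
      then show ?thesis using x by simp
    qed
    then show "x \<in> W \<and> ratio_of x \<le> r ^ n \<and> (\<forall>z. strict_prefix z x \<longrightarrow> r ^ n < ratio_of z)"
      using x by simp
  next
    assume *: "x \<in> W \<and> ratio_of x \<le> r ^ n \<and> (\<forall>z. strict_prefix z x \<longrightarrow> r ^ n < ratio_of z)"
    have "r ^ n < 1" using r_bounds False by (simp add: power_less_one_iff)
    then have "x \<noteq> []" using * by auto
    then have "strict_prefix (butlast x) x"
      by (metis append_butlast_last_id strict_prefixI' )
    then show "x \<in> X n" using * False \<open>x \<noteq> []\<close> by (auto simp: word_level_def)
  qed
qed

lemma X_W: "x \<in> X n \<Longrightarrow> x \<in> W" by (simp add: mem_X_iff)

lemma X_0 [simp]: "X 0 = {[]}" by (simp add: word_level_def)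

lemma X_ratio: assumes "x \<in> X n" shows "ratio_of x \<le> r ^ n" "r ^ Suc n < ratio_of x"
proof -
  show "ratio_of x \<le> r ^ n" using assms by (simp add: mem_X_iff)
  show "r ^ Suc n < ratio_of x"
  proof (cases "n = 0")
    case True then show ?thesis using assms r_bounds by simp
  next
    case False
    then have x: "x \<in> W" "x \<noteq> []" "r ^ n < ratio_of (butlast x)"
      using assms by (auto simp: word_level_def)
    have "ratio_of x = ratio_of (butlast x) * \<rho> (last x)"
      using ratio_append[of "butlast x" "[last x]"] x by simp
    moreover have "r \<le> \<rho> (last x)" using x by (intro r_le) auto
    ultimately show ?thesis using x r_bounds
      by (simp add: mult.commute) (smt (verit) mult_strict_mono mult_le_cancel_right mult_less_cancel_left_pos zero_less_power)
  qed
qed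

lemma X_antichain:
  assumes "x \<in> X n" "y \<in> X n" "prefix x y" shows "x = y"
  using assms by (fastforce simp: mem_X_iff strict_prefix_def)

lemma X_comparable:
  assumes "x \<in> X n" "y \<in> X n" "prefix x z" "prefix y z" shows "x = y"
  using prefix_same_cases[OF assms(3,4)] X_antichain assms(1,2) by metis

lemma X_disjoint:
  assumes "x \<in> X n" "x \<in> X m" shows "n = m"
proof -
  have "\<not> n < m" if "x \<in> X n" "x \<in> X m" for n m
  proof
    assume "n < m"
    then have "r ^ m \<le> r ^ Suc n" using r_bounds by (intro power_decreasing) auto
    then show False using X_ratio[OF that(1)] X_ratio[OF that(2)] by linarith
  qed
  then show ?thesis using assms by (meson linorder_neqE_nat)
qed

lemma ex_prefix_in_X:
  assumes "x \<in> W" "ratio_of x \<le> r ^ n" obtains z where "z \<in> X n" "prefix z x"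
proof -
  let ?P = "\<lambda>z. prefix z x \<and> ratio_of z \<le> r ^ n"
  have "?P x" using assms by simp
  then obtain z where z: "?P z" and min: "\<And>y. length y < length z \<Longrightarrow> \<not> ?P y"
    using arg_min_natI[of ?P x length] arg_min_nat_le[of ?P _ length] by (meson not_le)
  have "z \<in> X n"
    unfolding mem_X_iff
  proof (intro conjI allI impI)
    show "z \<in> W" using z assms prefix_W by blast
    show "ratio_of z \<le> r ^ n" using z by simp
    fix y assume y: "strict_prefix y z"
    then have "length y < length z" by (rule prefix_length_less)
    moreover have "prefix y x" using y z by (meson prefix_order.less_imp_le prefix_order.trans)
    ultimately show "r ^ n < ratio_of y" using min by (meson not_le)
  qed
  then show ?thesis using that z by blast
qed

lemma finite_X: "finite (X n)"
proof -
  obtain t where t: "0 < t" "t < 1" "\<And>i. i \<in> {1..N} \<Longrightarrow> \<rho> i \<le> t" using max_ratio by blast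
  obtain L where L: "t ^ L < r ^ n" using real_arch_pow_inv[of "r ^ n" t] r_bounds t by auto
  have "length x \<le> L" if x: "x \<in> X n" for x
  proof (rule ccontr)
    assume "\<not> length x \<le> L"
    then have "L < length x" by simp
    then have l: "length (take L x) = L" and s: "strict_prefix (take L x) x"
      by (auto simp: strict_prefix_def take_is_prefix)
    have "ratio_of (take L x) \<le> t ^ L"
      using ratio_le_power[OF t(3), of "take L x"] prefix_W[OF take_is_prefix X_W[OF x]] l by simp
    moreover have "r ^ n < ratio_of (take L x)" using x s by (simp add: mem_X_iff)
    ultimately show False using L by simp
  qed
  then have "X n \<subseteq> {x. set x \<subseteq> {1..N} \<and> length x \<le> L}" using X_W by auto
  then show ?thesis by (rule finite_subset) (simp add: finite_lists_length_le)
qed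

definition E :: "(nat list \<times> nat list) set" where
  "E = {(x, y). \<exists>n. x \<in> X n \<and> y \<in> X (Suc n) \<and> prefix x y}"

lemma E_up: assumes "(x, y) \<in> E" "(x', y) \<in> E" shows "x = x'"
proof -
  from assms obtain n n' where "x \<in> X n" "y \<in> X (Suc n)" "prefix x y"
    "x' \<in> X n'" "y \<in> X (Suc n')" "prefix x' y" by (auto simp: E_def)
  then show ?thesis using X_disjoint[of y "Suc n" "Suc n'"] X_comparable by auto
qed

lemma E_level: "(x, y) \<in> E \<Longrightarrow> y \<in> X (Suc n) \<Longrightarrow> x \<in> X n"
  using X_disjoint by (fastforce simp: E_def)

lemma E_level': "(x, y) \<in> E \<Longrightarrow> x \<in> X n \<Longrightarrow> y \<in> X (Suc n)"
  using X_disjoint by (fastforce simp: E_def)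

lemma E_prefix: "(x, y) \<in> E \<Longrightarrow> prefix x y" by (auto simp: E_def)

lemma ex_parent: assumes "y \<in> X (Suc n)" obtains x where "x \<in> X n" "(x, y) \<in> E"
proof -
  have "ratio_of y \<le> r ^ n"
    using order_trans[OF X_ratio(1)[OF assms] power_decreasing[of n "Suc n" r]] r_bounds by simp
  then obtain x where "x \<in> X n" "prefix x y" using ex_prefix_in_X X_W[OF assms] by blast
  then show ?thesis using that assms by (auto simp: E_def)
qed

lemma finite_offspring: "finite (E `` {x})"
proof (cases "\<exists>n. x \<in> X n")
  case True
  then obtain n where "x \<in> X n" ..
  then have "E `` {x} \<subseteq> X (Suc n)" using E_level' by auto
  then show ?thesis using finite_X finite_subset by blast
next
  case False then have "E `` {x} = {}" by (auto simp: E_def)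
  then show ?thesis by simp
qed

definition Codes :: "(nat \<Rightarrow> nat) set" where "Codes = {w. \<forall>j. w j \<in> {1..N}}"
definition pre :: "(nat \<Rightarrow> nat) \<Rightarrow> nat \<Rightarrow> nat list" where "pre w l = map w [0..<l]"

lemma pre_simps [simp]: "pre w 0 = []" "length (pre w l) = l" "pre w (Suc l) = pre w l @ [w l]"
  by (simp_all add: pre_def)

lemma pre_W: "w \<in> Codes \<Longrightarrow> pre w l \<in> W"
  by (auto simp: pre_def Codes_def)

lemma pre_prefix: "l \<le> l' \<Longrightarrow> prefix (pre w l) (pre w l')"
  by (induction rule: dec_induct) (auto intro: prefix_order.trans)

lemma pre_Cons: "pre w (Suc l) = w 0 # pre (\<lambda>j. w (Suc j)) l"
  by (simp add: pre_def upt_conv_Cons map_Suc_upt[symmetric] del: upt_Suc)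

text \<open>
  An infinite word passes through each level exactly once, at \<open>node w n\<close>.
\<close>
definition cut :: "(nat \<Rightarrow> nat) \<Rightarrow> nat \<Rightarrow> nat" where "cut w n = (LEAST l. pre w l \<in> X n)"
definition node :: "(nat \<Rightarrow> nat) \<Rightarrow> nat \<Rightarrow> nat list" where "node w n = pre w (cut w n)"

lemma node_in_X: assumes "w \<in> Codes" shows "node w n \<in> X n"
proof -
  obtain t where t: "0 < t" "t < 1" "\<And>i. i \<in> {1..N} \<Longrightarrow> \<rho> i \<le> t" using max_ratio by blast
  obtain L where L: "t ^ L < r ^ n" using real_arch_pow_inv[of "r ^ n" t] r_bounds t by auto
  have "ratio_of (pre w L) \<le> r ^ n"
    using ratio_le_power[OF t(3) pre_W[OF assms], of L] L by simp
  then obtain z where z: "z \<in> X n" "prefix z (pre w L)" using ex_prefix_in_X pre_W[OF assms] by blast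
  then have "z = pre w (length z)"
    by (auto simp: pre_def prefix_def map_eq_append_conv) (metis append_eq_conv_conj diff_zero length_map length_upt min.absorb1 prefixI prefix_length_le take_map take_upt add_0)
  then have "\<exists>l. pre w l \<in> X n" using z by metis
  then show ?thesis unfolding node_def cut_def by (rule LeastI_ex)
qed

lemma node_unique: assumes "w \<in> Codes" "pre w l \<in> X n" shows "cut w n = l"
proof -
  have "pre w (cut w n) \<in> X n" using node_in_X[OF assms(1)] by (simp add: node_def)
  moreover have "prefix (pre w l) (pre w (cut w n)) \<or> prefix (pre w (cut w n)) (pre w l)"
    using pre_prefix nat_le_linear by blast
  ultimately have "pre w (cut w n) = pre w l" using X_antichain assms(2) by metis
  then show ?thesis by (metis pre_simps(2))
qed

lemma cut_less: assumes "w \<in> Codes" shows "cut w n < cut w (Suc n)"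
proof (rule ccontr)
  assume "\<not> ?thesis"
  then have "prefix (node w (Suc n)) (node w n)" unfolding node_def by (intro pre_prefix) simp
  then have "ratio_of (node w n) \<le> ratio_of (node w (Suc n))"
    using X_W node_in_X[OF assms] by (intro ratio_prefix_mono) auto
  then show False using X_ratio[OF node_in_X[OF assms, of n]] X_ratio[OF node_in_X[OF assms, of "Suc n"]]
    by linarith
qed

lemma node_E: assumes "w \<in> Codes" shows "(node w n, node w (Suc n)) \<in> E"
  using node_in_X[OF assms] cut_less[OF assms, of n] pre_prefix[of "cut w n" "cut w (Suc n)" w]
  unfolding E_def node_def by auto

lemma le_cut: assumes "w \<in> Codes" shows "n \<le> cut w n"
  by (induction n) (use cut_less[OF assms] in \<open>auto simp: Suc_le_eq intro: le_less_trans\<close>)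

text \<open>
  Every path from the root downwards is the sequence of nodes of an infinite word.
\<close>
lemma chain_to_code:
  assumes v: "\<And>n. v n \<in> X n" and E: "\<And>n. (v n, v (Suc n)) \<in> E"
  shows "\<exists>w\<in>Codes. \<forall>n. node w n = v n"
proof -
  have mono: "prefix (v n) (v m)" if "n \<le> m" for n m
    using that by (induction rule: dec_induct) (use E_prefix[OF E] prefix_order.trans in auto)
  have "length (v n) < length (v (Suc n))" for n
  proof -
    have "v n \<noteq> v (Suc n)" using v[of n] v[of "Suc n"] X_disjoint by fastforce
    then show ?thesis using mono[of n "Suc n"] by (simp add: prefix_length_less strict_prefix_def)
  qed
  then have len: "n \<le> length (v n)" for n
    by (induction n) (auto simp: Suc_le_eq intro: le_less_trans)
  define w where "w j = v (Suc j) ! j" for j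
  have w: "w j = v n ! j" if "j < length (v n)" for j n
  proof -
    have "j < length (v (Suc j))" using len[of "Suc j"] by simp
    then show ?thesis using mono[of n "Suc j"] mono[of "Suc j" n] that
      by (cases "n \<le> Suc j") (auto simp: w_def prefix_def nth_append)
  qed
  have pre: "pre w (length (v n)) = v n" for n
    by (intro nth_equalityI) (auto simp: pre_def w)
  have "w \<in> Codes"
  proof -
    have "w j \<in> {1..N}" for j
    proof -
      have "j < length (v (Suc j))" using len[of "Suc j"] by simp
      then have "w j \<in> set (v (Suc j))" by (simp add: w_def)
      then show ?thesis using X_W[OF v] by blast
    qed
    then show ?thesis by (auto simp: Codes_def)
  qed
  moreover have "node w n = v n" for n
    using node_unique[OF \<open>w \<in> Codes\<close>, of "length (v n)" n] pre v by (simp add: node_def)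
  ultimately show ?thesis by (intro bexI[of _ w]) simp_all
qed

text \<open>
  Comparison of the two ways to measure where infinite words separate: by the ratio of the longest common prefix and by
  the level of the last common node.
\<close>
lemma node_split:
  assumes w: "w \<in> Codes" "w' \<in> Codes" and eq_l: "pre w l = pre w' l" and l: "w l \<noteq> w' l"
  obtains n where "node w n = node w' n" "node w (Suc n) \<noteq> node w' (Suc n)"
    "r ^ Suc n < ratio_of (pre w l)" "ratio_of (pre w l) \<le> r ^ n"
proof -
  have eq: "pre w j = pre w' j" if "j \<le> l" for j
    using arg_cong[OF eq_l, of "take j"] that by (simp add: pre_def take_map)
  define k where "k = (LEAST k. l < cut w k)"
  have "l < cut w (Suc l)" using le_cut[OF w(1), of "Suc l"] by simp
  then have k: "l < cut w k" unfolding k_def by (rule LeastI)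
  have "cut w 0 = 0" using node_unique[OF w(1), of 0 0] by simp
  then obtain n where n: "k = Suc n" using k by (cases k) auto
  have cn: "cut w n \<le> l" using not_less_Least[of n "\<lambda>k. l < cut w k"] n unfolding k_def by simp
  have nw: "pre w (cut w m) \<in> X m" for m using node_in_X[OF w(1)] by (simp add: node_def)
  show ?thesis
  proof
    have "cut w' n = cut w n" using nw[of n] eq[OF cn] by (intro node_unique[OF w(2)]) simp
    then show "node w n = node w' n" using eq[OF cn] by (simp add: node_def)
    show "node w (Suc n) \<noteq> node w' (Suc n)"
    proof
      assume *: "node w (Suc n) = node w' (Suc n)"
      then have "cut w (Suc n) = cut w' (Suc n)" unfolding node_def by (metis pre_simps(2))
      then have "w l = w' l" using * k n by (auto simp: node_def pre_def)
      then show False using l by simp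
    qed
    have "strict_prefix (pre w l) (pre w (cut w (Suc n)))"
      using pre_prefix[of l "cut w (Suc n)" w] k n by (auto simp: strict_prefix_def) (metis less_irrefl pre_simps(2))
    then show "r ^ Suc n < ratio_of (pre w l)" using nw[of "Suc n"] by (simp add: mem_X_iff)
    have "ratio_of (pre w l) \<le> ratio_of (pre w (cut w n))"
      using cn w by (intro ratio_prefix_mono pre_prefix pre_W)
    then show "ratio_of (pre w l) \<le> r ^ n" using nw[of n] by (simp add: mem_X_iff)
  qed
qed

section \<open>Codings\<close>

text \<open>
  The ratio of the longest common prefix is an ultrametric on infinite words; the definition says that \<open>f\<close> is
  bi-Lipschitz for it.
\<close>
definition tree_coding :: "('b \<Rightarrow> 'b \<Rightarrow> real) \<Rightarrow> ((nat \<Rightarrow> nat) \<Rightarrow> 'b) \<Rightarrow> bool" where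
  "tree_coding d f \<longleftrightarrow> (\<exists>c>0. \<exists>C>0. \<forall>w\<in>Codes. \<forall>w'\<in>Codes. \<forall>l. pre w l = pre w' l \<longrightarrow> w l \<noteq> w' l \<longrightarrow>
     c * ratio_of (pre w l) \<le> d (f w) (f w') \<and> d (f w) (f w') \<le> C * ratio_of (pre w l))"

lemma first_difference:
  fixes w w' :: "nat \<Rightarrow> nat"
  assumes "w \<noteq> w'" obtains l where "pre w l = pre w' l" "w l \<noteq> w' l"
proof -
  define l where "l = (LEAST l. w l \<noteq> w' l)"
  have "\<exists>l. w l \<noteq> w' l" using assms by auto
  then have "w l \<noteq> w' l" unfolding l_def by (rule LeastI_ex)
  moreover have "w j = w' j" if "j < l" for j using not_less_Least that unfolding l_def by blast
  then have "pre w l = pre w' l" by (auto simp: pre_def)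
  ultimately show ?thesis using that by blast
qed

lemma tree_coding_inj:
  assumes "tree_coding d f" "\<And>x. x \<in> f ` Codes \<Longrightarrow> d x x = 0" shows "inj_on f Codes"
proof (rule inj_onI)
  fix w w' assume w: "w \<in> Codes" "w' \<in> Codes" "f w = f w'"
  show "w = w'"
  proof (rule ccontr)
    assume "w \<noteq> w'"
    then obtain l where l: "pre w l = pre w' l" "w l \<noteq> w' l" by (rule first_difference)
    obtain c where "c > 0" "c * ratio_of (pre w l) \<le> d (f w) (f w')"
      using assms(1) w l unfolding tree_coding_def by blast
    moreover have "d (f w) (f w') = 0" using assms(2)[of "f w'"] w by simp
    moreover have "0 < ratio_of (pre w l)" using w pre_W ratio_pos by blast
    ultimately show False by (simp add: mult_le_0_iff)
  qed
qed

lemma lipschitz_equivalent_of_codings: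
  assumes f: "tree_coding (mdist m) f" "f ` Codes = mspace m"
    and g: "tree_coding (mdist m') g" "g ` Codes = mspace m'"
  shows "lipschitz_equivalent m m'"
proof -
  obtain c C where c: "c > 0" "C > 0" and cC: "\<And>w w' l. \<lbrakk>w \<in> Codes; w' \<in> Codes; pre w l = pre w' l; w l \<noteq> w' l\<rbrakk> \<Longrightarrow>
     c * ratio_of (pre w l) \<le> mdist m (f w) (f w') \<and> mdist m (f w) (f w') \<le> C * ratio_of (pre w l)"
    using f(1) unfolding tree_coding_def by blast
  obtain c' C' where c': "c' > 0" "C' > 0" and cC': "\<And>w w' l. \<lbrakk>w \<in> Codes; w' \<in> Codes; pre w l = pre w' l; w l \<noteq> w' l\<rbrakk> \<Longrightarrow>
     c' * ratio_of (pre w l) \<le> mdist m' (g w) (g w') \<and> mdist m' (g w) (g w') \<le> C' * ratio_of (pre w l)"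
    using g(1) unfolding tree_coding_def by blast
  have bf: "bij_betw f Codes (mspace m)"
    unfolding bij_betw_def using tree_coding_inj[OF f(1)] f(2) by simp
  have bg: "bij_betw g Codes (mspace m')"
    unfolding bij_betw_def using tree_coding_inj[OF g(1)] g(2) by simp
  let ?h = "g \<circ> inv_into Codes f"
  have bij: "bij_betw ?h (mspace m) (mspace m')"
    using bij_betw_trans[OF bij_betw_inv_into[OF bf] bg] .
  have "(c' / C) * mdist m x y \<le> mdist m' (?h x) (?h y) \<and> mdist m' (?h x) (?h y) \<le> (C' / c) * mdist m x y"
    if xy: "x \<in> mspace m" "y \<in> mspace m" for x y
  proof -
    define w w' where "w = inv_into Codes f x" and "w' = inv_into Codes f y"
    have w: "w \<in> Codes" "w' \<in> Codes" "f w = x" "f w' = y"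
      using bij_betwE[OF bij_betw_inv_into[OF bf]] xy bij_betw_inv_into_right[OF bf] by (auto simp: w_def w'_def)
    show ?thesis
    proof (cases "w = w'")
      case True
      then have "x = y" using w by simp
      moreover have "?h y \<in> mspace m'" using bij_betwE[OF bij] xy by blast
      ultimately have "mdist m x y = 0" "mdist m' (?h x) (?h y) = 0" using xy by simp_all
      then show ?thesis by simp
    next
      case False
      then obtain l where l: "pre w l = pre w' l" "w l \<noteq> w' l" by (rule first_difference)
      let ?q = "ratio_of (pre w l)"
      have 1: "c * ?q \<le> mdist m x y" "mdist m x y \<le> C * ?q" using cC[OF w(1,2) l] w by auto
      have 2: "c' * ?q \<le> mdist m' (?h x) (?h y)" "mdist m' (?h x) (?h y) \<le> C' * ?q"
        using cC'[OF w(1,2) l] by (auto simp: w_def w'_def)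
      have "(c' / C) * mdist m x y \<le> (c' / C) * (C * ?q)" using 1 c c' by (intro mult_left_mono) auto
      moreover have "(C' / c) * (c * ?q) \<le> (C' / c) * mdist m x y" using 1 c c' by (intro mult_left_mono) auto
      ultimately show ?thesis using 2 c by simp
    qed
  qed
  then show ?thesis
    unfolding lipschitz_equivalent_def using bij c c'
    by (intro exI[of _ ?h] exI[of _ "c' / C"] exI[of _ "C' / c"]) auto
qed

section \<open>A dust-like set with prescribed ratios\<close>

definition dust_map :: "nat \<Rightarrow> nat \<Rightarrow> (nat \<Rightarrow> real) \<Rightarrow> nat \<Rightarrow> real" where
  "dust_map k i x = (\<lambda>b. if b < k then (if b = 0 then \<rho> i * x (k - 1) + real i else \<rho> i * x (b - 1)) else 0)"

text \<open>
  The point with address \<open>w\<close>: the letter in position \<open>j\<close>, scaled by the ratio of the letters before it, is found in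
  coordinate \<open>j mod k\<close>.
\<close>
definition dust_point :: "nat \<Rightarrow> (nat \<Rightarrow> nat) \<Rightarrow> nat \<Rightarrow> real" where
  "dust_point k w =
     (\<lambda>b. if b < k then \<Sum>j. ratio_of (pre w (b + j * k)) * real (w (b + j * k)) else 0)"

text \<open>
  A cyclic shift of the coordinates is an isometry, so the map is a similitude.
\<close>
lemma dust_map_dist:
  assumes i: "i \<in> {1..N}" and k: "0 < k"
  shows "L2_set (\<lambda>b. dust_map k i x b - dust_map k i y b) {..<k} = \<rho> i * L2_set (\<lambda>b. x b - y b) {..<k}"
proof -
  obtain k' where k': "k = Suc k'" using k by (cases k) auto
  have "(\<Sum>b<k. (dust_map k i x b - dust_map k i y b)\<^sup>2)
      = (\<rho> i * x k' - \<rho> i * y k')\<^sup>2 + (\<Sum>b<k'. (\<rho> i * x b - \<rho> i * y b)\<^sup>2)"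
    unfolding k' sum.lessThan_Suc_shift by (simp add: dust_map_def)
  also have "\<dots> = (\<rho> i)\<^sup>2 * (\<Sum>b<k. (x b - y b)\<^sup>2)"
    unfolding k' by (simp add: sum_distrib_left right_diff_distrib[symmetric] power_mult_distrib distrib_left)
  finally show ?thesis
    unfolding L2_set_def using ratio[OF i] by (simp add: real_sqrt_mult)
qed

context
  fixes k :: nat and t :: real
  assumes k: "0 < k" and t: "0 < t" "t < 1" "\<And>i. i \<in> {1..N} \<Longrightarrow> \<rho> i \<le> t"
    and tk: "t ^ k * (2 * real N + 1) \<le> 1"
begin

lemma dust_summable:
  assumes w: "w \<in> Codes"
  shows "summable (\<lambda>j. ratio_of (pre w (b + j * k)) * real (w (b + j * k)))"
    and "0 \<le> (\<Sum>j. ratio_of (pre w (b + j * k)) * real (w (b + j * k)))"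
    and "(\<Sum>j. ratio_of (pre w (b + j * k)) * real (w (b + j * k))) \<le> t ^ b * (real N / (1 - t ^ k))"
proof -
  let ?f = "\<lambda>j. ratio_of (pre w (b + j * k)) * real (w (b + j * k))"
  have tk1: "t ^ k < 1" using t k by (simp add: power_less_one_iff)
  have pos: "0 \<le> ?f j" for j using ratio_pos[OF pre_W[OF w]] by (simp add: less_imp_le)
  have le: "?f j \<le> t ^ b * (real N * (t ^ k) ^ j)" for j
  proof -
    have "ratio_of (pre w (b + j * k)) \<le> t ^ (b + j * k)"
      using ratio_le_power[OF t(3) pre_W[OF w]] by simp
    moreover have "real (w (b + j * k)) \<le> real N" using w by (auto simp: Codes_def)
    ultimately have "?f j \<le> t ^ (b + j * k) * real N" using t by (intro mult_mono) auto
    also have "\<dots> = t ^ b * (real N * (t ^ k) ^ j)"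
      by (simp add: power_add power_mult[symmetric] mult.commute)
    finally show ?thesis .
  qed
  have sums: "(\<lambda>j. t ^ b * (real N * (t ^ k) ^ j)) sums (t ^ b * (real N * (1 / (1 - t ^ k))))"
    using tk1 t by (intro sums_mult geometric_sums) auto
  show s: "summable ?f"
    using pos le by (intro summable_comparison_test'[OF sums_summable[OF sums], of 0]) auto
  show "0 \<le> suminf ?f" using pos s by (intro suminf_nonneg)
  have "suminf ?f \<le> t ^ b * (real N * (1 / (1 - t ^ k)))"
    using suminf_le[OF le s sums_summable[OF sums]] sums_unique[OF sums] by simp
  then show "suminf ?f \<le> t ^ b * (real N / (1 - t ^ k))" by simp
qed

lemma dust_point_bounds:
  assumes "w \<in> Codes"
  shows "0 \<le> dust_point k w b" "dust_point k w b \<le> t ^ b * (real N / (1 - t ^ k))"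
proof -
  have "t ^ k < 1" using t k by (simp add: power_less_one_iff)
  then have "0 \<le> t ^ b * (real N / (1 - t ^ k))" using t by simp
  then show "0 \<le> dust_point k w b" "dust_point k w b \<le> t ^ b * (real N / (1 - t ^ k))"
    using dust_summable[OF assms] by (auto simp: dust_point_def)
qed

lemma dust_point_Cons:
  assumes w: "w \<in> Codes" and i: "i \<in> {1..N}"
  shows "dust_point k (case_nat i w) = dust_map k i (dust_point k w)"
proof
  fix b
  have preS: "pre (case_nat i w) (Suc l) = i # pre w l" for l by (simp add: pre_Cons del: pre_simps(3))
  show "dust_point k (case_nat i w) b = dust_map k i (dust_point k w) b"
  proof (cases b)
    case (Suc b')
    then show ?thesis
      using dust_summable(1)[OF w, of b']
      by (auto simp: dust_point_def dust_map_def preS suminf_mult mult.assoc simp del: pre_simps(3))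
  next
    case 0
    have iw: "case_nat i w \<in> Codes" using w i by (auto simp: Codes_def split: nat.split)
    obtain k' where k': "k = Suc k'" using k by (cases k) auto
    let ?f = "\<lambda>j. ratio_of (pre (case_nat i w) (0 + j * k)) * real (case_nat i w (0 + j * k))"
    have "suminf ?f = ?f 0 + (\<Sum>j. ?f (Suc j))"
      using suminf_split_head[OF dust_summable(1)[OF iw, of 0]] by simp
    also have "(\<lambda>j. ?f (Suc j)) = (\<lambda>j. \<rho> i * (ratio_of (pre w (k' + j * k)) * real (w (k' + j * k))))"
      by (simp add: k' preS mult.assoc add_ac del: pre_simps(3))
    also have "(\<Sum>j. \<rho> i * (ratio_of (pre w (k' + j * k)) * real (w (k' + j * k))))
        = \<rho> i * (\<Sum>j. ratio_of (pre w (k' + j * k)) * real (w (k' + j * k)))"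
      using dust_summable(1)[OF w] by (rule suminf_mult)
    finally show ?thesis using 0 k k' by (simp add: dust_point_def dust_map_def)
  qed
qed

lemma dust_point_decomp:
  assumes "w \<in> Codes"
  shows "dust_point k w = dust_map k (w 0) (dust_point k (\<lambda>j. w (Suc j)))"
    and "(\<lambda>j. w (Suc j)) \<in> Codes" "w 0 \<in> {1..N}"
proof -
  show s: "(\<lambda>j. w (Suc j)) \<in> Codes" "w 0 \<in> {1..N}" using assms by (auto simp: Codes_def)
  have "case_nat (w 0) (\<lambda>j. w (Suc j)) = w" by (auto split: nat.split)
  then show "dust_point k w = dust_map k (w 0) (dust_point k (\<lambda>j. w (Suc j)))"
    using dust_point_Cons[OF s] by simp
qed

text \<open>
  The first letter can be read off from coordinate 0: whatever the other letters add to this coordinate has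
  been scaled at least \<open>k\<close> times and sums up to at most one half.
\<close>
lemma dust_point_head:
  assumes "w \<in> Codes"
  shows "real (w 0) \<le> dust_point k w 0" "dust_point k w 0 \<le> real (w 0) + 1 / 2"
proof -
  let ?y = "dust_point k (\<lambda>j. w (Suc j)) (k - 1)"
  note d = dust_point_decomp[OF assms]
  have tk1: "t ^ k < 1" using t k by (simp add: power_less_one_iff)
  have y: "0 \<le> ?y" "?y \<le> t ^ (k - 1) * (real N / (1 - t ^ k))" using dust_point_bounds[OF d(2)] by auto
  have e: "dust_point k w 0 = \<rho> (w 0) * ?y + real (w 0)" using k by (subst d(1)) (simp add: dust_map_def)
  have "\<rho> (w 0) * ?y \<le> t * (t ^ (k - 1) * (real N / (1 - t ^ k)))"
    using y t(1) t(3)[OF d(3)] by (intro mult_mono) auto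
  also have "\<dots> = t ^ k * real N / (1 - t ^ k)" using k by (simp add: power_eq_if)
  also have "\<dots> \<le> 1 / 2" using tk tk1 by (simp add: field_simps)
  finally show "dust_point k w 0 \<le> real (w 0) + 1 / 2" using e by simp
  show "real (w 0) \<le> dust_point k w 0" using e y ratio[OF d(3)] by simp
qed

abbreviation dust_dist :: "(nat \<Rightarrow> real) \<Rightarrow> (nat \<Rightarrow> real) \<Rightarrow> real" where
  "dust_dist x y \<equiv> L2_set (\<lambda>b. x b - y b) {..<k}"

lemma dust_dist_head:
  assumes w: "w \<in> Codes" "w' \<in> Codes" "w 0 \<noteq> w' 0"
  shows "1 / 2 \<le> dust_dist (dust_point k w) (dust_point k w')"
proof -
  have "1 \<le> \<bar>real (w 0) - real (w' 0)\<bar>" using w(3) by linarith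
  then have "1 / 2 \<le> \<bar>dust_point k w 0 - dust_point k w' 0\<bar>"
    using dust_point_head[OF w(1)] dust_point_head[OF w(2)] by linarith
  also have "\<dots> \<le> dust_dist (dust_point k w) (dust_point k w')"
    using member_le_L2_set[of "{..<k}" 0 "\<lambda>b. \<bar>dust_point k w b - dust_point k w' b\<bar>"] k
    by (simp add: L2_set_def)
  finally show ?thesis .
qed

lemma dust_dist_le:
  assumes w: "w \<in> Codes" "w' \<in> Codes"
  shows "dust_dist (dust_point k w) (dust_point k w') \<le> real k * (real N / (1 - t ^ k))"
proof -
  have tk1: "t ^ k < 1" using t k by (simp add: power_less_one_iff)
  have *: "dust_point k w b \<le> real N / (1 - t ^ k)" if "w \<in> Codes" for w b
  proof -
    have "t ^ b \<le> 1" using t by (simp add: power_le_one)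
    then have "t ^ b * (real N / (1 - t ^ k)) \<le> 1 * (real N / (1 - t ^ k))"
      using tk1 by (intro mult_right_mono) auto
    then show ?thesis using dust_point_bounds(2)[OF that, of b] by simp
  qed
  have "dust_dist (dust_point k w) (dust_point k w') \<le> (\<Sum>b<k. \<bar>dust_point k w b - dust_point k w' b\<bar>)"
    by (rule L2_set_le_sum_abs)
  also have "\<dots> \<le> (\<Sum>b<k. real N / (1 - t ^ k))"
  proof (intro sum_mono)
    fix b show "\<bar>dust_point k w b - dust_point k w' b\<bar> \<le> real N / (1 - t ^ k)"
      using *[OF w(1), of b] *[OF w(2), of b] dust_point_bounds(1)[OF w(1), of b]
        dust_point_bounds(1)[OF w(2), of b] by linarith
  qed
  finally show ?thesis by simp
qed

text \<open>
  For words with different first letters both bounds are immediate; a common first letter contributes its ratio to each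
  side.
\<close>
lemma dust_coding_bounds:
  assumes "w \<in> Codes" "w' \<in> Codes" "pre w l = pre w' l" "w l \<noteq> w' l"
  shows "1 / 2 * ratio_of (pre w l) \<le> dust_dist (dust_point k w) (dust_point k w')
    \<and> dust_dist (dust_point k w) (dust_point k w') \<le> real k * (real N / (1 - t ^ k)) * ratio_of (pre w l)"
  using assms
proof (induction l arbitrary: w w')
  case 0
  then show ?case using dust_dist_head dust_dist_le by simp
next
  case (Suc l)
  let ?v = "\<lambda>j. w (Suc j)" and ?v' = "\<lambda>j. w' (Suc j)"
  note d = dust_point_decomp[OF Suc.prems(1)] and d' = dust_point_decomp[OF Suc.prems(2)]
  have h: "w 0 = w' 0" "pre ?v l = pre ?v' l"
    using Suc.prems(3) by (simp_all add: pre_Cons del: pre_simps(3))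
  note IH = Suc.IH[OF d(2) d'(2) h(2) Suc.prems(4)]
  have "dust_dist (dust_point k w) (dust_point k w') = \<rho> (w 0) * dust_dist (dust_point k ?v) (dust_point k ?v')"
    using dust_map_dist[OF d(3) k] d(1) d'(1) h(1) by simp
  moreover have "ratio_of (pre w (Suc l)) = \<rho> (w 0) * ratio_of (pre ?v l)"
    by (simp add: pre_Cons del: pre_simps(3))
  moreover have "\<rho> (w 0) * (1 / 2 * ratio_of (pre ?v l))
        \<le> \<rho> (w 0) * dust_dist (dust_point k ?v) (dust_point k ?v')"
    "\<rho> (w 0) * dust_dist (dust_point k ?v) (dust_point k ?v')
        \<le> \<rho> (w 0) * (real k * (real N / (1 - t ^ k)) * ratio_of (pre ?v l))"
    using mult_left_mono[OF conjunct1[OF IH] less_imp_le] mult_left_mono[OF conjunct2[OF IH] less_imp_le]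
      ratio[OF d(3)] by blast+
  ultimately show ?case by (simp only: mult_ac)
qed

lemma dust_coding: "tree_coding dust_dist (dust_point k)"
proof -
  have "t ^ k < 1" using t k by (simp add: power_less_one_iff)
  then have "0 < real k * (real N / (1 - t ^ k))" using k N by simp
  then show ?thesis unfolding tree_coding_def using dust_coding_bounds
    by (intro exI[of _ "1/2"] conjI exI[of _ "real k * (real N / (1 - t ^ k))"]) auto
qed

lemma dust_self_similar: "dust_point k ` Codes = (\<Union>i\<in>{1..N}. dust_map k i ` dust_point k ` Codes)"
proof
  show "dust_point k ` Codes \<subseteq> (\<Union>i\<in>{1..N}. dust_map k i ` dust_point k ` Codes)"
  proof
    fix x assume "x \<in> dust_point k ` Codes"
    then obtain w where "w \<in> Codes" "x = dust_point k w" by blast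
    then show "x \<in> (\<Union>i\<in>{1..N}. dust_map k i ` dust_point k ` Codes)"
      using dust_point_decomp[of w] by blast
  qed
  show "(\<Union>i\<in>{1..N}. dust_map k i ` dust_point k ` Codes) \<subseteq> dust_point k ` Codes"
  proof
    fix x assume "x \<in> (\<Union>i\<in>{1..N}. dust_map k i ` dust_point k ` Codes)"
    then obtain i w where iw: "i \<in> {1..N}" "w \<in> Codes" "x = dust_map k i (dust_point k w)" by blast
    then have "case_nat i w \<in> Codes" by (auto simp: Codes_def split: nat.split)
    then show "x \<in> dust_point k ` Codes" using iw dust_point_Cons by (metis imageI)
  qed
qed

text \<open>
  Points with different first letters have distance at least one half.
\<close>
lemma dust_like_dust: "dust_like N (dust_map k) (dust_point k ` Codes)"
  unfolding dust_like_def
proof (intro ballI impI equals0I)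
  fix i j x assume ij: "i \<in> {1..N}" "j \<in> {1..N}" "i \<noteq> j"
    and "x \<in> dust_map k i ` dust_point k ` Codes \<inter> dust_map k j ` dust_point k ` Codes"
  then obtain w w' where w: "w \<in> Codes" "w' \<in> Codes"
    and x: "x = dust_map k i (dust_point k w)" "x = dust_map k j (dust_point k w')" by blast
  have c: "case_nat i w \<in> Codes" "case_nat j w' \<in> Codes"
    using ij w by (auto simp: Codes_def split: nat.split)
  have "dust_point k (case_nat i w) = dust_point k (case_nat j w')"
    using x dust_point_Cons[OF w(1) ij(1)] dust_point_Cons[OF w(2) ij(2)] by simp
  then show False using dust_dist_head[OF c] ij(3) by (simp add: L2_set_def)
qed

lemma dust_ifs: "similitude_ifs (euclidean_n_metric k) N \<rho> (dust_map k)"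
  unfolding similitude_ifs_def contractive_similitude_def
  using N ratio dust_map_dist[OF _ k]
  by (auto simp: topspace_Euclidean_space dust_map_def)

end

text \<open>
  The bound on \<open>t ^ k\<close> makes the geometric tail \<open>N t\<^sup>k / (1 - t\<^sup>k)\<close> at most one half.
\<close>
lemma dust_parameters:
  obtains k t where "0 < k" "0 < t" "t < 1" "\<And>i. i \<in> {1..N} \<Longrightarrow> \<rho> i \<le> t" "t ^ k * (2 * real N + 1) \<le> 1"
proof -
  obtain t where t: "0 < t" "t < 1" "\<And>i. i \<in> {1..N} \<Longrightarrow> \<rho> i \<le> t" using max_ratio by blast
  obtain k where k: "t ^ k < 1 / (2 * real N + 1)"
    using real_arch_pow_inv[of "1 / (2 * real N + 1)" t] t by auto
  have "k \<noteq> 0" using k N by (intro notI) (simp add: field_simps)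
  then show ?thesis using that[of k t] t k by (simp add: field_simps)
qed

end

section \<open>Geometry of horizontal components\<close>

text \<open>
  The common setting of the augmented tree and its quotient: the vertices of each level carry compact cells that cover \<open>K\<close>,
  of diameter at most \<open>D q\<^sup>n\<close>, and horizontal edges join the cells with gap at most \<open>\<kappa> q\<^sup>n\<close>.
\<close>
locale cell_graph =
  fixes Z :: "'v level_graph" and cell :: "'v \<Rightarrow> 'a::euclidean_space set" and K :: "'a set"
    and q \<kappa> D :: real
  assumes q: "0 < q" "q < 1" and \<kappa>: "0 < \<kappa>" and D: "0 \<le> D"
    and finite_level: "finite (level Z n)"
    and level_disjoint: "x \<in> level Z n \<Longrightarrow> x \<in> level Z n' \<Longrightarrow> n = n'"
    and cell: "x \<in> level Z n \<Longrightarrow> compact (cell x) \<and> cell x \<noteq> {}"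
    and cell_dist: "x \<in> level Z n \<Longrightarrow> a \<in> cell x \<Longrightarrow> b \<in> cell x \<Longrightarrow> dist a b \<le> D * q ^ n"
    and cover: "K = (\<Union>x\<in>level Z n. cell x)"
    and horiz_iff: "(x, y) \<in> horiz Z \<longleftrightarrow>
      (\<exists>n. x \<in> level Z n \<and> y \<in> level Z n \<and> x \<noteq> y \<and> setdist (cell x) (cell y) \<le> \<kappa> * q ^ n)"
begin

definition component :: "'v \<Rightarrow> 'v set" where "component x = (horiz Z)\<^sup>* `` {x}"
definition body :: "'v set \<Rightarrow> 'a set" where "body T = (\<Union>x\<in>T. cell x)"

lemma sym_horiz: "sym (horiz Z)"
  unfolding sym_def horiz_iff using setdist_sym by metis

lemma component_self: "x \<in> component x" by (simp add: component_def)

lemma component_eq: "y \<in> component x \<Longrightarrow> component y = component x"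
  unfolding component_def using sym_rtrancl[OF sym_horiz] by (auto dest: symD intro: rtrancl_trans)

lemma component_level: assumes x: "x \<in> level Z n" shows "component x \<subseteq> level Z n"
proof
  fix y assume "y \<in> component x"
  then have "(x, y) \<in> (horiz Z)\<^sup>*" by (simp add: component_def)
  then show "y \<in> level Z n"
  proof induction
    case (step y z)
    then show ?case using level_disjoint horiz_iff by metis
  qed (use x in simp)
qed

text \<open>
  A path that starts in a component stays in it.
\<close>
lemma component_connected: "horizontally_connected Z (component x)"
  unfolding horizontally_connected_def
proof (intro conjI ballI)
  show "component x \<noteq> {}" using component_self by auto
  fix y z assume y: "y \<in> component x" and z: "z \<in> component x"
  have "(y, z) \<in> (horiz Z)\<^sup>*" using z component_eq[OF y] by (auto simp: component_def)
  then show "(y, z) \<in> (horiz Z \<inter> component x \<times> component x)\<^sup>*"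
  proof induction
    case (step z' z)
    have "z' \<in> component y" using step by (simp add: component_def)
    moreover have "z \<in> component y" using step by (auto simp: component_def)
    ultimately have "(z', z) \<in> horiz Z \<inter> component x \<times> component x" using component_eq[OF y] step by simp
    then show ?case using step.IH by (rule rtrancl_into_rtrancl[rotated])
  qed simp
qed

lemma connected_subset_comp:
  assumes "horizontally_connected Z T" "x \<in> T" shows "T \<subseteq> component x"
proof
  fix y assume "y \<in> T"
  then have "(x, y) \<in> (horiz Z \<inter> T \<times> T)\<^sup>*" using assms by (simp add: horizontally_connected_def)
  then have "(x, y) \<in> (horiz Z)\<^sup>*" by (rule rtrancl_mono[THEN subsetD, rotated]) simp
  then show "y \<in> component x" by (simp add: component_def)
qed

lemma components_iff: "T \<in> horizontal_components Z \<longleftrightarrow> (\<exists>n. \<exists>x\<in>level Z n. T = component x)"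
proof
  assume "T \<in> horizontal_components Z"
  then obtain n where T: "T \<subseteq> level Z n" "horizontally_connected Z T"
    and max: "\<And>T'. T \<subseteq> T' \<Longrightarrow> T' \<subseteq> level Z n \<Longrightarrow> horizontally_connected Z T' \<Longrightarrow> T' = T"
    unfolding horizontal_components_def by auto
  then obtain x where x: "x \<in> T" by (auto simp: horizontally_connected_def)
  then have xn: "x \<in> level Z n" using T by auto
  have "component x = T"
    by (intro max component_level connected_subset_comp component_connected) (use T x xn in simp_all)
  then show "\<exists>n. \<exists>x\<in>level Z n. T = component x" using xn by auto
next
  assume "\<exists>n. \<exists>x\<in>level Z n. T = component x"
  then obtain n x where x: "x \<in> level Z n" "T = component x" by auto
  have "T' = T" if "T \<subseteq> T'" "horizontally_connected Z T'" for T'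
    using connected_subset_comp[OF that(2), of x] component_self[of x] that x by auto
  then show "T \<in> horizontal_components Z"
    unfolding horizontal_components_def
    using component_level[OF x(1)] component_connected[of x] unfolding x(2)[symmetric]
    by (intro CollectI exI[of _ n]) simp
qed

lemma component_unique: "T \<in> horizontal_components Z \<Longrightarrow> x \<in> T \<Longrightarrow> T = component x"
  using components_iff component_eq by auto

text \<open>
  Two cells at distance at most \<open>\<kappa> q\<^sup>n\<close> are joined by a horizontal edge, so they lie in the same component.
\<close>
lemma bodies_apart:
  assumes x: "x \<in> level Z n" "y \<in> level Z n" and ne: "component x \<noteq> component y"
    and a: "a \<in> body (component x)" and b: "b \<in> body (component y)"
  shows "\<kappa> * q ^ n < dist a b"
proof (rule ccontr)
  assume *: "\<not> ?thesis"
  obtain x' y' where x': "x' \<in> component x" "a \<in> cell x'" and y': "y' \<in> component y" "b \<in> cell y'"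
    using a b by (auto simp: body_def)
  have l: "x' \<in> level Z n" "y' \<in> level Z n" using component_level x x' y' by auto
  have "x' \<noteq> y'" using component_eq[OF x'(1)] component_eq[OF y'(1)] ne by auto
  moreover have "setdist (cell x') (cell y') \<le> \<kappa> * q ^ n"
    using setdist_le_dist[OF x'(2) y'(2)] * by simp
  ultimately have "(x', y') \<in> horiz Z" using l horiz_iff by auto
  then have "y' \<in> component x'" by (auto simp: component_def)
  then show False using component_eq[OF x'(1)] component_eq[OF y'(1)] ne component_eq by metis
qed

text \<open>
  Each step of a horizontal path adds at most the gap \<open>\<kappa> q\<^sup>n\<close> and the diameter of one more cell.
\<close>
lemma path_dist:
  assumes R: "R \<subseteq> horiz Z" and x: "x \<in> level Z n" and xy: "(x, y) \<in> R ^^ k"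
    and a: "a \<in> cell x" and b: "b \<in> cell y"
  shows "dist a b \<le> (D + real k * (D + \<kappa>)) * q ^ n"
  using xy b
proof (induction k arbitrary: y b)
  case 0
  then show ?case using cell_dist[OF x a] by simp
next
  case (Suc k)
  then obtain z where z: "(x, z) \<in> R ^^ k" "(z, y) \<in> R" by auto
  have zn: "z \<in> level Z n"
  proof -
    have "(x, z) \<in> R\<^sup>*" using z(1) by (rule relpow_imp_rtrancl)
    then have "z \<in> component x" unfolding component_def using rtrancl_mono[OF R] by auto
    then show ?thesis using component_level[OF x] by auto
  qed
  have "(z, y) \<in> horiz Z" using z(2) R by auto
  then obtain n' where "z \<in> level Z n'" "y \<in> level Z n'" "setdist (cell z) (cell y) \<le> \<kappa> * q ^ n'"
    unfolding horiz_iff by auto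
  then have yn: "y \<in> level Z n" and sd: "setdist (cell z) (cell y) \<le> \<kappa> * q ^ n"
    using level_disjoint[OF zn] by auto
  obtain c d where cd: "c \<in> cell z" "d \<in> cell y" "dist c d = setdist (cell z) (cell y)"
    using setdist_compact_closed[of "cell z" "cell y"] cell[OF zn] cell[OF yn] compact_imp_closed by auto
  have "dist a b \<le> dist a c + dist c d + dist d b"
    using dist_triangle[of a b c] dist_triangle[of c b d] by linarith
  also have "\<dots> \<le> (D + real k * (D + \<kappa>)) * q ^ n + \<kappa> * q ^ n + D * q ^ n"
    using Suc.IH[OF z(1) cd(1)] sd cd(3) cell_dist[OF yn cd(2) Suc.prems(2)] by linarith
  also have "\<dots> = (D + real (Suc k) * (D + \<kappa>)) * q ^ n" by (simp add: algebra_simps)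
  finally show ?case .
qed

text \<open>
  A component with at most \<open>M\<close> vertices has at most \<open>M * M\<close> edges, which bounds the length of a connecting path.
\<close>
lemma bodies_small:
  assumes M: "\<And>T. T \<in> horizontal_components Z \<Longrightarrow> card T \<le> M"
    and x: "x \<in> level Z n" and a: "a \<in> body (component x)" and b: "b \<in> body (component x)"
  shows "dist a b \<le> (D + real (M * M) * (D + \<kappa>)) * q ^ n"
proof -
  obtain y z where y: "y \<in> component x" "a \<in> cell y" and z: "z \<in> component x" "b \<in> cell z"
    using a b by (auto simp: body_def)
  let ?R = "horiz Z \<inter> component x \<times> component x"
  have fin: "finite (component x)" using component_level[OF x] finite_level finite_subset by blast
  then have finR: "finite ?R" by simp
  have "(y, z) \<in> ?R\<^sup>*" using component_connected y z unfolding horizontally_connected_def by simp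
  then obtain k where k: "k \<le> card ?R" "(y, z) \<in> ?R ^^ k"
    unfolding rtrancl_finite_eq_relpow[OF finR] by auto
  have "component x \<in> horizontal_components Z" using components_iff x by auto
  then have c: "card (component x) \<le> M" by (rule M)
  have "card ?R \<le> card (component x \<times> component x)" using fin by (intro card_mono) auto
  also have "\<dots> \<le> M * M" using c by (simp add: card_cartesian_product mult_le_mono)
  finally have "k \<le> M * M" using k by simp
  have yn: "y \<in> level Z n" using component_level[OF x] y by auto
  have "dist a b \<le> (D + real k * (D + \<kappa>)) * q ^ n"
    by (rule path_dist[OF _ yn k(2) y(2) z(2)]) simp
  also have "\<dots> \<le> (D + real (M * M) * (D + \<kappa>)) * q ^ n"
    using \<open>k \<le> M * M\<close> D \<kappa> q by (intro mult_right_mono add_left_mono) (auto simp del: of_nat_mult)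
  finally show ?thesis .
qed

lemma in_body: assumes "p \<in> K" obtains x where "x \<in> level Z n" "p \<in> body (component x)"
proof -
  obtain x where "x \<in> level Z n" "p \<in> cell x" using assms cover[of n] by auto
  then show ?thesis using that component_self by (auto simp: body_def)
qed

lemma compact_body: assumes "x \<in> level Z n" shows "compact (body (component x))" "body (component x) \<noteq> {}"
proof -
  have "finite (component x)" using component_level[OF assms] finite_level finite_subset by blast
  then show "compact (body (component x))"
    unfolding body_def using component_level[OF assms] cell by (intro compact_UN) auto
  show "body (component x) \<noteq> {}" using component_self cell[OF assms] by (auto simp: body_def)
qed

text \<open>
  At a level so deep that bodies are shorter than the distance of two given points, the body of the first point and the
  union of the other bodies are disjoint closed sets that separate these points.
\<close>
lemma connected_subset_singleton:
  assumes M: "\<And>T. T \<in> horizontal_components Z \<Longrightarrow> card T \<le> M"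
    and U: "connected U" "U \<subseteq> K"
  shows "\<exists>a. U \<subseteq> {a}"
proof -
  have "a = b" if ab: "a \<in> U" "b \<in> U" for a b
  proof (rule ccontr)
    assume "a \<noteq> b"
    define C where "C = D + real (M * M) * (D + \<kappa>)"
    have C: "0 \<le> C" using D \<kappa> by (simp add: C_def)
    obtain n where n: "q ^ n < dist a b / (C + 1)"
      using real_arch_pow_inv[of "dist a b / (C + 1)" q] q C \<open>a \<noteq> b\<close> by auto
    have "C * q ^ n \<le> (C + 1) * q ^ n" using q by simp
    also have "\<dots> < dist a b" using n C by (simp add: field_simps)
    finally have small: "C * q ^ n < dist a b" .
    obtain x where x: "x \<in> level Z n" "a \<in> body (component x)" using in_body ab U by blast
    let ?I = "{y \<in> level Z n. component y \<noteq> component x}"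
    let ?B = "\<Union>y\<in>?I. body (component y)"
    have "b \<notin> body (component x)" using bodies_small[OF M x(1) x(2)] small unfolding C_def by fastforce
    have "finite ?I" using finite_level by simp
    then have closed: "closed (body (component x))" "closed ?B"
      using compact_body x(1) compact_imp_closed by (blast, intro closed_UN) blast+
    have cov: "U \<subseteq> body (component x) \<union> ?B"
    proof
      fix p assume "p \<in> U"
      then obtain y where "y \<in> level Z n" "p \<in> body (component y)" using in_body U by blast
      then show "p \<in> body (component x) \<union> ?B" by auto
    qed
    have disj: "body (component x) \<inter> ?B = {}"
    proof (rule equals0I)
      fix p assume "p \<in> body (component x) \<inter> ?B"
      then obtain y where "y \<in> level Z n" "component y \<noteq> component x" "p \<in> body (component x)" "p \<in> body (component y)" by auto
      then have "\<kappa> * q ^ n < dist p p" using bodies_apart[OF x(1), of y p p] by auto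
      moreover have "0 < \<kappa> * q ^ n" using \<kappa> q by simp
      ultimately show False by simp
    qed
    have "b \<in> ?B" using subsetD[OF cov ab(2)] \<open>b \<notin> body (component x)\<close> by simp
    moreover have "body (component x) \<inter> U = {} \<or> ?B \<inter> U = {}"
      by (rule connected_closedD[OF U(1) _ cov closed]) (simp add: disj)
    ultimately show False using x(2) ab by blast
  qed
  then show ?thesis by (cases "U = {}") blast+
qed

end

section \<open>The augmented tree and its quotient as cell graphs\<close>

text \<open>
  The size of a component is the sum of its class counts, and there are only finitely many classes of components.
\<close>
lemma bounded_components:
  assumes \<tau>: "bij_betw \<tau> {1..m} (component_classes Z)"
    and \<sigma>: "bij_betw \<sigma> {1..n} (vertex_classes (vertices Z) R)"
    and u: "is_representation m \<tau> n \<sigma> u"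
  shows "\<exists>M. \<forall>T\<in>horizontal_components Z. card T \<le> M"
proof (intro exI ballI)
  fix T assume T: "T \<in> horizontal_components Z"
  from quotient_index[OF equiv_component_equiv \<tau>[unfolded component_classes_def]]
  obtain c where c: "(\<forall>T\<in>horizontal_components Z. c T \<in> {1..m}) \<and>
    (\<forall>i\<in>{1..m}. \<forall>T. T \<in> \<tau> i \<longleftrightarrow> T \<in> horizontal_components Z \<and> c T = i)" ..
  from quotient_index[OF equiv_subtree_equiv \<sigma>[unfolded vertex_classes_def]]
  obtain t where t: "(\<forall>x\<in>vertices Z. t x \<in> {1..n}) \<and>
    (\<forall>j\<in>{1..n}. \<forall>x. x \<in> \<sigma> j \<longleftrightarrow> x \<in> vertices Z \<and> t x = j)" ..
  have cT: "c T \<in> {1..m}" "T \<in> \<tau> (c T)" using c T by auto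
  have TV: "T \<subseteq> vertices Z" using T by (auto simp: horizontal_components_def vertices_def)
  have "T = (\<Union>j\<in>{1..n}. T \<inter> \<sigma> j)" using TV t by blast
  then have "card T \<le> (\<Sum>j\<in>{1..n}. card (T \<inter> \<sigma> j))"
    using card_UN_le[of "{1..n}" "\<lambda>j. T \<inter> \<sigma> j"] by simp
  also have "\<dots> = (\<Sum>j\<in>{1..n}. u (c T) j)"
    using u cT unfolding is_representation_def by (intro sum.cong refl) simp
  also have "\<dots> \<le> (\<Sum>i\<in>{1..m}. \<Sum>j\<in>{1..n}. u i j)"
    using cT by (intro member_le_sum[of "c T" "{1..m}" "\<lambda>i. \<Sum>j\<in>{1..n}. u i j"]) auto
  finally show "card T \<le> (\<Sum>i\<in>{1..m}. \<Sum>j\<in>{1..n}. u i j)" .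
qed

locale similitude_system = ratio_system N \<rho> for N :: nat and \<rho> :: "nat \<Rightarrow> real" +
  fixes S :: "nat \<Rightarrow> 'a::euclidean_space \<Rightarrow> 'a" and K :: "'a set" and \<kappa> :: real
  assumes S_dist: "i \<in> {1..N} \<Longrightarrow> dist (S i a) (S i b) = \<rho> i * dist a b"
    and compact_K: "compact K" and K_ne: "K \<noteq> {}"
    and K_eq: "K = (\<Union>i\<in>{1..N}. S i ` K)" and \<kappa>_pos: "0 < \<kappa>"
begin

abbreviation cell :: "nat list \<Rightarrow> 'a set" where "cell x \<equiv> word_map S x ` K"
abbreviation Aug :: "nat list level_graph" where "Aug \<equiv> augmented_tree N \<rho> S K \<kappa>"
abbreviation Quot :: "nat list set level_graph" where "Quot \<equiv> quotient_tree N \<rho> S K \<kappa>"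
abbreviation H :: "nat list set set" where "H \<equiv> horizontal_components Aug"

lemma word_map_append: "word_map S (x @ y) = word_map S x \<circ> word_map S y"
  by (induction x) (auto simp: comp_assoc)

lemma word_map_dist: "x \<in> W \<Longrightarrow> dist (word_map S x a) (word_map S x b) = ratio_of x * dist a b"
  by (induction x) (auto simp: S_dist)

lemma cell_subset_K: "x \<in> W \<Longrightarrow> cell x \<subseteq> K"
proof (induction x)
  case (Cons i x)
  then have "S i ` cell x \<subseteq> S i ` K" "i \<in> {1..N}" by (simp_all add: image_mono)
  moreover have "S i ` K \<subseteq> K" if "i \<in> {1..N}" for i using that by (subst (2) K_eq) blast
  ultimately show ?case by (auto simp add: image_comp)
qed simp

lemma cell_prefix: "prefix x y \<Longrightarrow> y \<in> W \<Longrightarrow> cell y \<subseteq> cell x"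
proof -
  assume "prefix x y" "y \<in> W"
  then obtain z where "y = x @ z" by (auto simp: prefix_def)
  with \<open>y \<in> W\<close> have y: "y = x @ z" "z \<in> W" by simp_all
  have "cell y = word_map S x ` cell z" by (simp add: y(1) word_map_append image_comp)
  also have "\<dots> \<subseteq> cell x" using cell_subset_K[OF y(2)] by (rule image_mono)
  finally show ?thesis .
qed

lemma compact_cell: assumes "x \<in> W" shows "compact (cell x)"
proof -
  have "(ratio_of x)-lipschitz_on K (word_map S x)"
    using word_map_dist[OF assms] ratio_pos[OF assms] by (intro lipschitz_onI) auto
  then show ?thesis by (intro compact_continuous_image compact_K) (rule lipschitz_on_continuous_on)
qed

lemma cell_dist_le:
  assumes x: "x \<in> X n" and a: "a \<in> cell x" "b \<in> cell x" shows "dist a b \<le> diameter K * r ^ n"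
proof -
  obtain a' b' where ab: "a' \<in> K" "b' \<in> K" "a = word_map S x a'" "b = word_map S x b'" using a by auto
  have "dist a b = ratio_of x * dist a' b'" using ab word_map_dist X_W[OF x] by simp
  also have "\<dots> \<le> r ^ n * diameter K"
    using X_ratio(1)[OF x] ratio_pos[OF X_W[OF x]] diameter_bounded_bound[OF compact_imp_bounded[OF compact_K] ab(1,2)]
    by (intro mult_mono) auto
  finally show ?thesis by (simp add: mult.commute)
qed

lemma K_step: assumes "a \<in> K" shows "\<exists>i\<in>{1..N}. \<exists>b\<in>K. a = S i b"
  using assms by (subst (asm) K_eq) auto

text \<open>
  Iterating the self-similarity equation gives every point of \<open>K\<close> an address.
\<close>
lemma point_has_code:
  assumes "p \<in> K" obtains w where "w \<in> Codes" "\<And>l. p \<in> cell (pre w l)"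
proof -
  have "\<exists>z. fst z \<in> {1..N} \<and> snd z \<in> K \<and> a = S (fst z) (snd z)" if "a \<in> K" for a
  proof -
    obtain i b where "i \<in> {1..N}" "b \<in> K" "a = S i b" using K_step[OF \<open>a \<in> K\<close>] by auto
    then show ?thesis by (intro exI[of _ "(i, b)"]) simp
  qed
  then have "\<forall>a\<in>K. \<exists>z. fst z \<in> {1..N} \<and> snd z \<in> K \<and> a = S (fst z) (snd z)" by simp
  from bchoice[OF this] obtain F where
    F: "\<forall>a\<in>K. fst (F a) \<in> {1..N} \<and> snd (F a) \<in> K \<and> a = S (fst (F a)) (snd (F a))" ..
  define f h where "f a = fst (F a)" and "h a = snd (F a)" for a
  have fh: "f a \<in> {1..N} \<and> h a \<in> K \<and> a = S (f a) (h a)" if "a \<in> K" for a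
    using F that by (simp add: f_def h_def)
  define w where "w j = f ((h ^^ j) p)" for j
  have hK: "(h ^^ j) p \<in> K" for j using assms fh by (induction j) auto
  have "p = word_map S (pre w l) ((h ^^ l) p)" for l
  proof (induction l)
    case (Suc l)
    have "(h ^^ l) p = S (w l) ((h ^^ Suc l) p)" using fh[OF hK[of l]] by (simp add: w_def)
    then have "word_map S (pre w l) ((h ^^ l) p) = word_map S (pre w (Suc l)) ((h ^^ Suc l) p)"
      by (simp add: word_map_append)
    with Suc show ?case by (rule trans)
  qed simp
  then have "p \<in> cell (pre w l)" for l using imageI[OF hK[of l], of "word_map S (pre w l)"] by simp
  moreover have "w \<in> Codes" using fh[OF hK] by (simp add: Codes_def w_def)
  ultimately show ?thesis using that[of w] by simp
qed

lemma cells_cover: "K = (\<Union>x\<in>X n. cell x)"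
proof
  show "K \<subseteq> (\<Union>x\<in>X n. cell x)"
  proof
    fix p assume "p \<in> K"
    then obtain w where "w \<in> Codes" "\<And>l. p \<in> cell (pre w l)" using point_has_code by blast
    then show "p \<in> (\<Union>x\<in>X n. cell x)" using node_in_X[of w n] unfolding node_def by blast
  qed
  show "(\<Union>x\<in>X n. cell x) \<subseteq> K" using cell_subset_K X_W by blast
qed

lemma level_aug [simp]: "level Aug n = X n" by (simp add: augmented_tree_def)
lemma vert_aug [simp]: "vert Aug = E" by (simp add: augmented_tree_def E_def)

sublocale tree: cell_graph Aug cell K r \<kappa> "diameter K"
proof
  show "0 \<le> diameter K" by (rule diameter_ge_0[OF compact_imp_bounded[OF compact_K]])
  show "compact (cell x) \<and> cell x \<noteq> {}" if "x \<in> level Aug n" for x n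
    using that compact_cell X_W K_ne by simp
  show "(x, y) \<in> horiz Aug \<longleftrightarrow> (\<exists>n. x \<in> level Aug n \<and> y \<in> level Aug n \<and> x \<noteq> y \<and>
      setdist (cell x) (cell y) \<le> \<kappa> * r ^ n)" for x y
    by (simp add: augmented_tree_def)
qed (use r_bounds \<kappa>_pos finite_X X_disjoint cell_dist_le cells_cover in simp_all)

abbreviation same_map :: "nat \<Rightarrow> (nat list \<times> nat list) set" where
  "same_map n \<equiv> {(x, y). x \<in> X n \<and> y \<in> X n \<and> word_map S x = word_map S y}"

abbreviation class_cell :: "nat list set \<Rightarrow> 'a set" where "class_cell a \<equiv> (\<Union>x\<in>a. cell x)"

lemma equiv_same_map: "equiv (X n) (same_map n)"
  by (rule equivI) (auto simp: refl_on_def sym_def trans_def)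

lemma level_quot: "level Quot n = X n // same_map n"
  by (simp add: quotient_tree_def Let_def)

lemma class_cell_eq: assumes a: "a \<in> level Quot n" and x: "x \<in> a" shows "class_cell a = cell x" "x \<in> X n"
proof -
  have "word_map S y = word_map S x" if "y \<in> a" for y
    using quotient_eq_iff[OF equiv_same_map a[unfolded level_quot] a[unfolded level_quot] that x] by simp
  then have "class_cell a = (\<Union>y\<in>a. cell x)" by (intro SUP_cong) simp_all
  then show "class_cell a = cell x" using x by auto
  show "x \<in> X n" using in_quotient_imp_subset[OF equiv_same_map a[unfolded level_quot]] x by auto
qed

lemma class_nonempty: "a \<in> level Quot n \<Longrightarrow> \<exists>x. x \<in> a"
  using in_quotient_imp_non_empty[OF equiv_same_map, of a n] unfolding level_quot by auto

lemma level_quot_disjoint: "a \<in> level Quot n \<Longrightarrow> a \<in> level Quot n' \<Longrightarrow> n = n'"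
  using class_nonempty[of a n] class_cell_eq(2)[of a n] class_cell_eq(2)[of a n'] X_disjoint by blast

lemma classes_cover: "(\<Union>a\<in>level Quot n. class_cell a) = (\<Union>x\<in>X n. cell x)"
proof -
  have "(\<Union>a\<in>level Quot n. class_cell a) = (\<Union>x\<in>\<Union>(level Quot n). cell x)" by auto
  then show ?thesis using Union_quotient[OF equiv_same_map, of n] by (simp add: level_quot)
qed

text \<open>
  Equivalent words have the same cell, so whether two classes are joined does not depend on representatives.
\<close>
lemma horiz_quot: "(a, b) \<in> horiz Quot \<longleftrightarrow> (\<exists>n. a \<in> level Quot n \<and> b \<in> level Quot n \<and> a \<noteq> b \<and>
      setdist (class_cell a) (class_cell b) \<le> \<kappa> * r ^ n)"
proof
  assume "(a, b) \<in> horiz Quot"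
  then obtain n n' x y where ab: "a \<in> level Quot n" "b \<in> level Quot n'" "a \<noteq> b" "x \<in> a" "y \<in> b" "(x, y) \<in> horiz Aug"
    by (auto simp: quotient_tree_def Let_def)
  then obtain l where l: "x \<in> X l" "y \<in> X l" "setdist (cell x) (cell y) \<le> \<kappa> * r ^ l"
    by (auto simp: tree.horiz_iff)
  have "l = n" "l = n'"
    using X_disjoint[OF l(1) class_cell_eq(2)[OF ab(1,4)]] X_disjoint[OF l(2) class_cell_eq(2)[OF ab(2,5)]]
    by auto
  then show "\<exists>n. a \<in> level Quot n \<and> b \<in> level Quot n \<and> a \<noteq> b \<and>
      setdist (class_cell a) (class_cell b) \<le> \<kappa> * r ^ n"
    using l(3) ab(1-3) class_cell_eq(1)[OF ab(1,4)] class_cell_eq(1)[OF ab(2,5)]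
    by (intro exI[of _ n]) simp
next
  assume "\<exists>n. a \<in> level Quot n \<and> b \<in> level Quot n \<and> a \<noteq> b \<and>
      setdist (class_cell a) (class_cell b) \<le> \<kappa> * r ^ n"
  then obtain n where ab: "a \<in> level Quot n" "b \<in> level Quot n" "a \<noteq> b"
    "setdist (class_cell a) (class_cell b) \<le> \<kappa> * r ^ n" by blast
  obtain x y where xy: "x \<in> a" "y \<in> b" using class_nonempty[OF ab(1)] class_nonempty[OF ab(2)] by auto
  have "x \<noteq> y"
    using quotient_disj[OF equiv_same_map ab(1,2)[unfolded level_quot]] ab(3) xy by auto
  moreover have "x \<in> X n" "y \<in> X n"
    using class_cell_eq(2)[OF ab(1) xy(1)] class_cell_eq(2)[OF ab(2) xy(2)] by auto
  moreover have "setdist (cell x) (cell y) \<le> \<kappa> * r ^ n"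
    using ab(4) class_cell_eq(1)[OF ab(1) xy(1)] class_cell_eq(1)[OF ab(2) xy(2)] by simp
  ultimately have "(x, y) \<in> horiz Aug" by (auto simp: tree.horiz_iff)
  then show "(a, b) \<in> horiz Quot"
    using ab(1-3) xy by (auto simp: quotient_tree_def Let_def)
qed

sublocale quotient: cell_graph Quot class_cell K r \<kappa> "diameter K"
proof
  show "finite (level Quot n)" for n
    unfolding level_quot by (rule finite_quotient[OF finite_X]) auto
  show "compact (class_cell a) \<and> class_cell a \<noteq> {}" if a: "a \<in> level Quot n" for a n
  proof -
    obtain x where "x \<in> a" using class_nonempty[OF a] by blast
    then show ?thesis using class_cell_eq[OF a] tree.cell[of x n] by simp
  qed
  show "dist p p' \<le> diameter K * r ^ n" if a: "a \<in> level Quot n" and p: "p \<in> class_cell a" "p' \<in> class_cell a" for a n p p'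
  proof -
    obtain x where "x \<in> a" using class_nonempty[OF a] by blast
    then have "class_cell a = cell x" "x \<in> X n" using class_cell_eq[OF a] by auto
    then show ?thesis using cell_dist_le p by auto
  qed
  show "K = (\<Union>a\<in>level Quot n. class_cell a)" for n using classes_cover cells_cover by simp
qed (use r_bounds \<kappa>_pos level_quot_disjoint horiz_quot tree.D in simp_all)

end

section \<open>Matching components with words\<close>

context similitude_system
begin

lemma E_vertices: "(x, y) \<in> E \<Longrightarrow> x \<in> vertices Aug \<and> y \<in> vertices Aug"
  unfolding E_def vertices_def by auto

lemma H_finite: "T \<in> H \<Longrightarrow> finite T"
  using finite_X finite_subset unfolding horizontal_components_def by auto

lemma H_nonempty: "T \<in> H \<Longrightarrow> T \<noteq> {}"
  unfolding horizontal_components_def horizontally_connected_def by auto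

lemma H_level: assumes "T \<in> H" obtains n where "T \<subseteq> X n"
  using assms unfolding horizontal_components_def by auto

lemma H_unique: "T \<in> H \<Longrightarrow> T' \<in> H \<Longrightarrow> x \<in> T \<Longrightarrow> x \<in> T' \<Longrightarrow> T = T'"
  using tree.component_unique[of T x] tree.component_unique[of T' x] by simp

lemma E_offspring_level: "T \<subseteq> X n \<Longrightarrow> E `` T \<subseteq> X (Suc n)"
  using E_level' by auto

text \<open>
  Cells decrease along the tree and the allowed gap increases towards the root.  Hence the parents of horizontal
  neighbours coincide or are neighbours themselves, and a component lies below one component.
\<close>
lemma offspring_connected:
  assumes xy: "(x, y) \<in> E" and y: "y \<in> X (Suc n)"
  shows "tree.component y \<subseteq> E `` tree.component x"
proof
  fix z assume "z \<in> tree.component y"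
  then have "(y, z) \<in> (horiz Aug)\<^sup>*" by (simp add: tree.component_def)
  then have "z \<in> X (Suc n) \<and> (\<exists>v. (v, z) \<in> E \<and> v \<in> tree.component x)"
  proof induction
    case base
    then show ?case using xy y tree.component_self by blast
  next
    case (step z z')
    then obtain v where v: "(v, z) \<in> E" "v \<in> tree.component x" and z: "z \<in> X (Suc n)" by blast
    obtain l where l: "z \<in> X l" "z' \<in> X l" "setdist (cell z) (cell z') \<le> \<kappa> * r ^ l"
      using step(2) by (auto simp: tree.horiz_iff)
    have z': "z' \<in> X (Suc n)" and sd: "setdist (cell z) (cell z') \<le> \<kappa> * r ^ Suc n"
      using l X_disjoint[OF l(1) z] by auto
    obtain v' where v': "v' \<in> X n" "(v', z') \<in> E" using ex_parent[OF z'] by blast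
    have vn: "v \<in> X n" using E_level[OF v(1) z] .
    have "setdist (cell v) (cell v') \<le> setdist (cell z) (cell v')"
      using cell_prefix[OF E_prefix[OF v(1)] X_W[OF z]] K_ne by (intro setdist_subset_left) auto
    also have "\<dots> \<le> setdist (cell z) (cell z')"
      using cell_prefix[OF E_prefix[OF v'(2)] X_W[OF z']] K_ne by (intro setdist_subset_right) auto
    also have "\<dots> \<le> \<kappa> * r ^ Suc n" by (rule sd)
    also have "\<dots> \<le> \<kappa> * r ^ n"
      using \<kappa>_pos r_bounds by (intro mult_left_mono power_decreasing) auto
    finally have "v = v' \<or> (v, v') \<in> horiz Aug" using vn v' by (auto simp: tree.horiz_iff)
    then have "v' \<in> tree.component x"
      using v(2) unfolding tree.component_def by (auto intro: rtrancl_into_rtrancl)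
    then show ?case using z' v' by blast
  qed
  then show "z \<in> E `` tree.component x" by blast
qed

lemma ex_parent_component:
  assumes T': "T' \<in> H" "T' \<subseteq> X (Suc n)"
  obtains T where "T \<in> H" "T \<subseteq> X n" "T' \<subseteq> E `` T"
proof -
  obtain y where y: "y \<in> T'" using H_nonempty[OF T'(1)] by auto
  then have yX: "y \<in> X (Suc n)" using T' by auto
  obtain x where x: "x \<in> X n" "(x, y) \<in> E" using ex_parent[OF yX] by blast
  have "T' = tree.component y" using T'(1) y by (rule tree.component_unique)
  moreover have "tree.component x \<in> H" using x unfolding tree.components_iff by auto
  moreover have "tree.component x \<subseteq> X n" using tree.component_level[of x n] x by simp
  ultimately show ?thesis using that[of "tree.component x"] offspring_connected[OF x(2) yX] by simp
qed

lemma parent_component_unique: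
  assumes "T1 \<in> H" "T2 \<in> H" "y \<in> E `` T1" "y \<in> E `` T2" shows "T1 = T2"
proof -
  obtain x1 x2 where x: "x1 \<in> T1" "(x1, y) \<in> E" "x2 \<in> T2" "(x2, y) \<in> E" using assms by auto
  then have "x1 = x2" using E_up by blast
  then show ?thesis using H_unique[OF assms(1,2)] x by auto
qed

definition parent :: "nat list \<Rightarrow> nat list" where "parent y = (THE x. (x, y) \<in> E)"

lemma parent_eq: "(x, y) \<in> E \<Longrightarrow> parent y = x"
  unfolding parent_def using E_up by blast

lemma parent_level: assumes "y \<in> X (Suc n)" shows "parent y \<in> X n" "(parent y, y) \<in> E"
proof -
  obtain x where "x \<in> X n" "(x, y) \<in> E" using ex_parent[OF assms] by blast
  then show "parent y \<in> X n" "(parent y, y) \<in> E" using parent_eq by auto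
qed

lemma distinct_rows:
  assumes \<sigma>: "bij_betw \<sigma> {1..n} (vertex_classes (vertices Aug) E)"
    and ty: "\<forall>x\<in>vertices Aug. ty x \<in> {1..n}"
      "\<forall>j\<in>{1..n}. \<forall>x. x \<in> \<sigma> j \<longleftrightarrow> x \<in> vertices Aug \<and> ty x = j"
    and B: "is_tree_incidence E n \<sigma> B"
    and j: "j \<in> {1..n}" "j' \<in> {1..n}" and eq: "\<forall>k\<in>{1..n}. B j k = B j' k"
  shows "j = j'"
proof -
  let ?R = "{(x, y). x \<in> vertices Aug \<and> y \<in> vertices Aug \<and> subtree_equiv E x y}"
  note eqv = equiv_subtree_equiv[of "vertices Aug" E]
  have cls: "\<sigma> j \<in> vertices Aug // ?R" if "j \<in> {1..n}" for j
    using bij_betwE[OF \<sigma>] that unfolding vertex_classes_def by blast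
  have ne: "\<sigma> j \<noteq> {}" if "j \<in> {1..n}" for j
    using in_quotient_imp_non_empty[OF eqv cls[OF that]] .
  obtain x y where x: "x \<in> \<sigma> j" and y: "y \<in> \<sigma> j'" using ne j by blast
  have xV: "x \<in> vertices Aug" and yV: "y \<in> vertices Aug" and tx: "ty x = j" and tyy: "ty y = j'"
    using x y ty(2) j by auto
  have tyV: "z \<in> \<sigma> (ty z)" if "z \<in> vertices Aug" for z using that ty by auto
  have same: "subtree_equiv E z z'" if "z \<in> vertices Aug" "z' \<in> vertices Aug" "ty z = ty z'" for z z'
  proof -
    have "(z, z') \<in> ?R"
      using tyV[OF that(1)] tyV[OF that(2)] that(3) ty(1) that(1)
      by (intro in_quotient_imp_in_rel[OF eqv cls[of "ty z"]]) auto
    then show ?thesis by simp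
  qed
  have set_eq: "{z \<in> E `` {v}. ty z = k} = {z \<in> \<sigma> k. (v, z) \<in> E}" if "k \<in> {1..n}" for v k
    using ty(2) that E_vertices by auto
  have "subtree_equiv E x y"
  proof (rule subtree_equiv_of_equal_offspring[where lev = "\<lambda>x. THE n. x \<in> X n" and t = ty and Q = "{1..n}"])
    show "(THE n. y \<in> X n) = Suc (THE n. x \<in> X n)" if xy: "(x, y) \<in> E" for x y
    proof -
      obtain l where "x \<in> X l" "y \<in> X (Suc l)" using xy by (auto simp: E_def)
      then have "(THE n. x \<in> X n) = l" "(THE n. y \<in> X n) = Suc l" using X_disjoint by blast+
      then show ?thesis by simp
    qed
    show "card {z \<in> E `` {x}. ty z = k} = card {z \<in> E `` {y}. ty z = k}" if k: "k \<in> {1..n}" for k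
    proof -
      have "B j k = card {z \<in> \<sigma> k. (x, z) \<in> E}" "B j' k = card {z \<in> \<sigma> k. (y, z) \<in> E}"
        using B x y j k unfolding is_tree_incidence_def by auto
      then show ?thesis using eq k set_eq[OF k] by simp
    qed
    show "x = x'" if "(x, y) \<in> E" "(x', y) \<in> E" for x x' y using E_up that .
    show "finite (E `` {x})" "finite (E `` {y})" by (rule finite_offspring)+
    show "ty z \<in> {1..n}" if "z \<in> E `` {x} \<union> E `` {y}" for z
      using that E_vertices ty(1) by auto
    show "subtree_equiv E z z'" if "z \<in> E `` {x}" "z' \<in> E `` {y}" "ty z = ty z'" for z z'
      using that E_vertices same by auto
  qed
  then have "(x, y) \<in> ?R" using xV yV by simp
  then have "y \<in> \<sigma> j" using in_quotient_imp_closed[OF eqv cls[OF j(1)] x] by blast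
  then show ?thesis using ty(2) j(1) tyy by auto
qed

text \<open>
  A map \<open>g\<close> on level \<open>l\<close> encodes the sets of words assigned to the components \<open>T\<close> of this level, as its fibres.
\<close>
definition good_grouping :: "nat \<Rightarrow> (nat list \<Rightarrow> nat) \<Rightarrow> nat \<Rightarrow> (nat list \<Rightarrow> nat list set) \<Rightarrow> bool" where
  "good_grouping n ty l g \<longleftrightarrow> (\<forall>y\<in>X l. g y \<in> H \<and> g y \<subseteq> X l) \<and>
     (\<forall>T\<in>H. T \<subseteq> X l \<longrightarrow> (\<forall>k\<in>{1..n}. card {y \<in> X l. ty y = k \<and> g y = T} = card {y \<in> T. ty y = k}))"

text \<open>
  The words assigned to a component of the next level are offspring of one single word assigned to the component above
  it.
\<close>
definition refines :: "nat \<Rightarrow> (nat list \<Rightarrow> nat list set) \<Rightarrow> (nat list \<Rightarrow> nat list set) \<Rightarrow> bool" where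
  "refines l g g' \<longleftrightarrow> (\<forall>y\<in>X (Suc l). g' y \<subseteq> E `` g (parent y)) \<and>
     (\<forall>y\<in>X (Suc l). \<forall>y'\<in>X (Suc l). g' y = g' y' \<longrightarrow> parent y = parent y')"

lemma refinesD:
  assumes "refines l g g'" "y \<in> X (Suc l)"
  shows "g' y \<subseteq> E `` g (parent y)"
    and "y' \<in> X (Suc l) \<Longrightarrow> g' y = g' y' \<Longrightarrow> parent y = parent y'"
proof -
  note R = assms(1)[unfolded refines_def]
  show "g' y \<subseteq> E `` g (parent y)" by (rule bspec[OF conjunct1[OF R] assms(2)])
  show "y' \<in> X (Suc l) \<Longrightarrow> g' y = g' y' \<Longrightarrow> parent y = parent y'"
    by (rule mp[OF bspec[OF bspec[OF conjunct2[OF R] assms(2)]]])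
qed

text \<open>
  Each component \<open>T\<close> of level \<open>l\<close> is treated separately by \<open>rearrangement_step\<close>, applied to its fibre \<open>?G T\<close> under \<open>g\<close>.
  The resulting maps have disjoint domains, because every vertex of the next level has one parent.
\<close>
lemma grouping_step:
  assumes \<tau>: "bij_betw \<tau> {1..m} (component_classes Aug)"
    and \<sigma>: "bij_betw \<sigma> {1..n} (vertex_classes (vertices Aug) E)"
    and cty: "\<forall>T\<in>H. cty T \<in> {1..m}" "\<forall>i\<in>{1..m}. \<forall>T. T \<in> \<tau> i \<longleftrightarrow> T \<in> H \<and> cty T = i"
    and ty: "\<forall>x\<in>vertices Aug. ty x \<in> {1..n}"
      "\<forall>j\<in>{1..n}. \<forall>x. x \<in> \<sigma> j \<longleftrightarrow> x \<in> vertices Aug \<and> ty x = j"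
    and A: "is_component_incidence Aug m \<tau> A" and B: "is_tree_incidence E n \<sigma> B"
    and u: "is_representation m \<tau> n \<sigma> u" and R: "rearrangeable m n B u A"
    and g: "good_grouping n ty l g"
  shows "\<exists>g'. good_grouping n ty (Suc l) g' \<and> refines l g g'"
proof -
  have XV: "X j \<subseteq> vertices Aug" for j unfolding vertices_def by auto
  have count: "card {y \<in> T. ty y = k} = u (cty T) k" if T: "T \<in> H" and k: "k \<in> {1..n}" for T k
  proof -
    obtain j where "T \<subseteq> X j" using H_level[OF T] .
    then have "T \<subseteq> vertices Aug" using XV by blast
    then have "{y \<in> T. ty y = k} = T \<inter> \<sigma> k" using ty(2) k by auto
    moreover have "u (cty T) k = card (T \<inter> \<sigma> k)"
      using u cty T k unfolding is_representation_def by auto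
    ultimately show ?thesis by simp
  qed
  let ?G = "\<lambda>T. {x \<in> X l. g x = T}" and ?D = "\<lambda>T. {T' \<in> H. T' \<subseteq> E `` T}"
  define Y where "Y T = (\<Union>v\<in>?G T. E `` {v})" for T
  have Y: "y \<in> Y T \<longleftrightarrow> y \<in> X (Suc l) \<and> g (parent y) = T" for y T
  proof
    assume "y \<in> Y T"
    then obtain v where v: "v \<in> X l" "g v = T" "(v, y) \<in> E" by (auto simp: Y_def)
    then show "y \<in> X (Suc l) \<and> g (parent y) = T"
      using E_level'[OF v(3,1)] parent_eq[OF v(3)] by simp
  next
    assume "y \<in> X (Suc l) \<and> g (parent y) = T"
    then show "y \<in> Y T" using parent_level[of y l] by (auto simp: Y_def)
  qed
  define good where "good T q \<longleftrightarrow> (\<forall>y\<in>Y T. q y \<in> ?D T) \<and>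
      (\<forall>d\<in>?D T. \<forall>k\<in>{1..n}. card {y \<in> Y T. ty y = k \<and> q y = d} = u (cty d) k) \<and>
      (\<forall>y\<in>Y T. \<forall>y'\<in>Y T. q y = q y' \<longrightarrow> parent y = parent y')" for T q
  have "\<exists>q. good T q"
    if T: "T \<in> H" "T \<subseteq> X l" for T
  proof -
    have "finite (Pow (X (Suc l)))" using finite_X by simp
    moreover have "?D T \<subseteq> Pow (X (Suc l))" using E_offspring_level[OF T(2)] by auto
    ultimately have finD: "finite (?D T)" by (rule rev_finite_subset)
    show ?thesis
    proof (rule rearrangement_step[where G = "?G T" and D = "?D T" and ch = "\<lambda>v. E `` {v}"
          and par = parent and ty = ty and cty = cty and n = n and m = m and B = B and u = u
          and A = A and i = "cty T"])
      show "finite (?G T)" using finite_X by simp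
      show "finite (?D T)" by (rule finD)
      show "finite (E `` {v})" for v by (rule finite_offspring)
      show "parent y = v" if "y \<in> E `` {v}" for v y using that parent_eq by simp
      show "ty \<in> ?G T \<rightarrow> {1..n}" using ty(1) XV[of l] by (intro Pi_I) blast
      show "ty \<in> E `` {v} \<rightarrow> {1..n}" for v using ty(1) E_vertices by auto
      show "cty \<in> ?D T \<rightarrow> {1..m}" using cty(1) by auto
      show "j = j'" if "j \<in> {1..n}" "j' \<in> {1..n}" "\<forall>k\<in>{1..n}. B j k = B j' k" for j j'
        using distinct_rows[OF \<sigma> ty B that] .
      show "rearrangeable m n B u A" by (rule R)
      show "cty T \<in> {1..m}" using cty(1) T by simp
      show "card {v \<in> ?G T. ty v = k} = u (cty T) k" if k: "k \<in> {1..n}" for k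
      proof -
        have "{v \<in> ?G T. ty v = k} = {y \<in> X l. ty y = k \<and> g y = T}" by auto
        then show ?thesis using g T k count[OF T(1) k] unfolding good_grouping_def by simp
      qed
      show "card {d \<in> ?D T. cty d = j} = A (cty T) j" if j: "j \<in> {1..m}" for j
      proof -
        have "T \<in> \<tau> (cty T)" using cty T by simp
        then have "A (cty T) j = card {T' \<in> \<tau> j. T' \<subseteq> E `` T}"
          using A j cty(1) T unfolding is_component_incidence_def by simp
        moreover have "{T' \<in> \<tau> j. T' \<subseteq> E `` T} = {d \<in> ?D T. cty d = j}" using cty(2) j by auto
        ultimately show ?thesis by simp
      qed
      show "card {y \<in> E `` {v}. ty y = k} = B (ty v) k" if v: "v \<in> ?G T" and k: "k \<in> {1..n}" for v k
      proof -
        have vV: "v \<in> vertices Aug" using v XV by auto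
        have "{y \<in> E `` {v}. ty y = k} = {y \<in> \<sigma> k. (v, y) \<in> E}" using ty(2) k E_vertices by auto
        moreover have "B (ty v) k = card {y \<in> \<sigma> k. (v, y) \<in> E}"
          using B ty vV k unfolding is_tree_incidence_def by simp
        ultimately show ?thesis by simp
      qed
      fix q
      assume "\<And>y. y \<in> (\<Union>v\<in>?G T. E `` {v}) \<Longrightarrow> q y \<in> ?D T"
        "\<And>d k. d \<in> ?D T \<Longrightarrow> k \<in> {1..n} \<Longrightarrow>
           card {y \<in> (\<Union>v\<in>?G T. E `` {v}). ty y = k \<and> q y = d} = u (cty d) k"
        "\<And>y y'. \<lbrakk>y \<in> (\<Union>v\<in>?G T. E `` {v}); y' \<in> (\<Union>v\<in>?G T. E `` {v}); q y = q y'\<rbrakk>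
           \<Longrightarrow> parent y = parent y'"
      note q = this[folded Y_def]
      show ?thesis unfolding good_def by (intro exI[of _ q] conjI ballI impI) (rule q; assumption)+
    qed
  qed
  then have "\<forall>T\<in>{T \<in> H. T \<subseteq> X l}. \<exists>q. good T q" by simp
  from bchoice[OF this] obtain q where "\<forall>T\<in>{T \<in> H. T \<subseteq> X l}. good T (q T)" ..
  then have "good T (q T)" if "T \<in> H" "T \<subseteq> X l" for T using that by simp
  note Q = this[unfolded good_def]
  have q_in: "q T y \<in> ?D T" if "T \<in> H" "T \<subseteq> X l" "y \<in> Y T" for T y
    by (rule bspec[OF conjunct1[OF Q[OF that(1,2)]] that(3)])
  have q_card: "card {y \<in> Y T. ty y = k \<and> q T y = d} = u (cty d) k"
    if "T \<in> H" "T \<subseteq> X l" "d \<in> ?D T" "k \<in> {1..n}" for T d k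
    by (rule bspec[OF bspec[OF conjunct1[OF conjunct2[OF Q[OF that(1,2)]]] that(3)] that(4)])
  have q_sib: "parent y = parent y'"
    if "T \<in> H" "T \<subseteq> X l" "y \<in> Y T" "y' \<in> Y T" "q T y = q T y'" for T y y'
    by (rule mp[OF bspec[OF bspec[OF conjunct2[OF conjunct2[OF Q[OF that(1,2)]]] that(3)] that(4)] that(5)])
  define g' where "g' y = q (g (parent y)) y" for y
  have gp: "g (parent y) \<in> H" "g (parent y) \<subseteq> X l" if "y \<in> X (Suc l)" for y
    using bspec[OF conjunct1[OF g[unfolded good_grouping_def]] parent_level(1)[OF that]] by simp_all
  have g'D: "g' y \<in> H" "g' y \<subseteq> E `` g (parent y)" if y: "y \<in> X (Suc l)" for y
  proof -
    have "y \<in> Y (g (parent y))" using y Y by simp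
    then have "q (g (parent y)) y \<in> ?D (g (parent y))" by (rule q_in[OF gp[OF y]])
    then show "g' y \<in> H" "g' y \<subseteq> E `` g (parent y)" by (simp_all add: g'_def)
  qed
  have 1: "g' y \<in> H \<and> g' y \<subseteq> X (Suc l)" if "y \<in> X (Suc l)" for y
    using g'D[OF that] E_offspring_level[OF gp(2)[OF that]] by auto
  have same: "g (parent y) = T" if y: "y \<in> X (Suc l)" and T: "T \<in> H" "g' y \<subseteq> E `` T" for y T
  proof -
    obtain z where "z \<in> g' y" using H_nonempty[OF g'D(1)[OF y]] by auto
    then show ?thesis
      using g'D(2)[OF y] gp(1)[OF y] T by (intro parent_component_unique[of _ _ z]) auto
  qed
  have 2: "card {y \<in> X (Suc l). ty y = k \<and> g' y = T'} = card {y \<in> T'. ty y = k}"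
    if T': "T' \<in> H" "T' \<subseteq> X (Suc l)" and k: "k \<in> {1..n}" for T' k
  proof -
    obtain T where T: "T \<in> H" "T \<subseteq> X l" "T' \<subseteq> E `` T" using ex_parent_component[OF T'] .
    have "{y \<in> X (Suc l). ty y = k \<and> g' y = T'} = {y \<in> Y T. ty y = k \<and> q T y = T'}"
    proof (intro set_eqI iffI)
      fix y assume y: "y \<in> {y \<in> X (Suc l). ty y = k \<and> g' y = T'}"
      then have "g (parent y) = T" using same[of y T] T by simp
      then show "y \<in> {y \<in> Y T. ty y = k \<and> q T y = T'}" using y by (simp add: Y g'_def)
    next
      fix y assume "y \<in> {y \<in> Y T. ty y = k \<and> q T y = T'}"
      then show "y \<in> {y \<in> X (Suc l). ty y = k \<and> g' y = T'}" by (simp add: Y g'_def)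
    qed
    moreover have "card {y \<in> Y T. ty y = k \<and> q T y = T'} = u (cty T') k"
      by (rule q_card[OF T(1,2) _ k]) (use T(3) T'(1) in simp)
    ultimately show ?thesis using count[OF T'(1) k] by simp
  qed
  have 3: "parent y = parent y'" if y: "y \<in> X (Suc l)" "y' \<in> X (Suc l)" "g' y = g' y'" for y y'
  proof -
    have T: "g (parent y') = g (parent y)"
      using same[OF y(2) gp(1)[OF y(1)]] g'D(2)[OF y(1)] y(3) by simp
    have "y \<in> Y (g (parent y))" "y' \<in> Y (g (parent y))" using y T Y by simp_all
    moreover have "q (g (parent y)) y = q (g (parent y)) y'" using y(3) T by (simp add: g'_def)
    ultimately show ?thesis by (rule q_sib[OF gp[OF y(1)]])
  qed
  have "good_grouping n ty (Suc l) g'"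
    unfolding good_grouping_def by (intro conjI ballI impI conjunct1[OF 1] conjunct2[OF 1] 2)
  moreover have "refines l g g'"
    unfolding refines_def by (intro conjI ballI impI) (rule g'D(2) 3; assumption)+
  ultimately show ?thesis by (intro exI[of _ g'] conjI)
qed

lemma ex_grouping:
  assumes \<tau>: "bij_betw \<tau> {1..m} (component_classes Aug)"
    and \<sigma>: "bij_betw \<sigma> {1..n} (vertex_classes (vertices Aug) E)"
    and A: "is_component_incidence Aug m \<tau> A" and B: "is_tree_incidence E n \<sigma> B"
    and u: "is_representation m \<tau> n \<sigma> u" and R: "rearrangeable m n B u A"
  shows "\<exists>g. (\<forall>l. \<forall>y\<in>X l. g l y \<in> H \<and> g l y \<subseteq> X l) \<and>
    (\<forall>l. \<forall>T\<in>H. T \<subseteq> X l \<longrightarrow> (\<exists>y\<in>X l. g l y = T)) \<and> (\<forall>l. refines l (g l) (g (Suc l)))"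
proof -
  from quotient_index[OF equiv_component_equiv \<tau>[unfolded component_classes_def]]
  obtain cty where cty: "(\<forall>T\<in>H. cty T \<in> {1..m}) \<and>
    (\<forall>i\<in>{1..m}. \<forall>T. T \<in> \<tau> i \<longleftrightarrow> T \<in> H \<and> cty T = i)" ..
  from quotient_index[OF equiv_subtree_equiv \<sigma>[unfolded vertex_classes_def]]
  obtain ty where ty: "(\<forall>x\<in>vertices Aug. ty x \<in> {1..n}) \<and>
    (\<forall>j\<in>{1..n}. \<forall>x. x \<in> \<sigma> j \<longleftrightarrow> x \<in> vertices Aug \<and> ty x = j)" ..
  have "\<exists>g. \<forall>l. good_grouping n ty l (g l) \<and> refines l (g l) (g (Suc l))"
  proof (rule dependent_nat_choice)
    have root: "T = {[]}" if "T \<in> H" "T \<subseteq> X 0" for T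
      using that H_nonempty by auto
    have "tree.component [] \<in> H" "tree.component [] \<subseteq> X 0"
      using tree.component_level[of "[]" 0] by (auto simp: tree.components_iff intro!: exI[of _ 0])
    then have "{[]} \<in> H" using root by metis
    moreover have "card {y \<in> X 0. ty y = k \<and> {[]} = T} = card {y \<in> T. ty y = k}"
      if "T \<in> H" "T \<subseteq> X 0" for T k
      unfolding root[OF that] by simp
    ultimately have "good_grouping n ty 0 (\<lambda>_. {[]})" by (simp add: good_grouping_def)
    then show "\<exists>g. good_grouping n ty 0 g" by (intro exI[of _ "\<lambda>_. {[]}"])
    show "\<exists>g'. good_grouping n ty (Suc l) g' \<and> refines l g g'" if "good_grouping n ty l g" for g l
      by (rule grouping_step[OF \<tau> \<sigma> conjunct1[OF cty] conjunct2[OF cty] conjunct1[OF ty] conjunct2[OF ty] A B u R that])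
  qed
  then obtain g where g: "\<forall>l. good_grouping n ty l (g l) \<and> refines l (g l) (g (Suc l))" ..
  have "\<exists>y\<in>X l. g l y = T" if T: "T \<in> H" "T \<subseteq> X l" for T l
  proof -
    obtain x where x: "x \<in> T" using H_nonempty[OF T(1)] by blast
    then have "x \<in> vertices Aug" using T(2) by (auto simp: vertices_def)
    then have k: "ty x \<in> {1..n}" using ty by blast
    have "0 < card {y \<in> T. ty y = ty x}" using x H_finite[OF T(1)] by (auto simp: card_gt_0_iff)
    then have "0 < card {y \<in> X l. ty y = ty x \<and> g l y = T}"
      using g T k unfolding good_grouping_def by simp
    then show ?thesis by (auto simp: card_gt_0_iff)
  qed
  then show ?thesis using g unfolding good_grouping_def by (intro exI[of _ g]) simp
qed

context
  fixes g :: "nat \<Rightarrow> nat list \<Rightarrow> nat list set"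
  assumes gH: "y \<in> X l \<Longrightarrow> g l y \<in> H" and gX: "y \<in> X l \<Longrightarrow> g l y \<subseteq> X l"
    and g_onto: "T \<in> H \<Longrightarrow> T \<subseteq> X l \<Longrightarrow> \<exists>y\<in>X l. g l y = T"
    and g_ref: "refines l (g l) (g (Suc l))"
begin

abbreviation piece :: "(nat \<Rightarrow> nat) \<Rightarrow> nat \<Rightarrow> 'a set" where
  "piece w l \<equiv> tree.body (g l (node w l))"

lemma body_mono:
  assumes "T' \<subseteq> E `` T" "T' \<subseteq> X (Suc l)" shows "tree.body T' \<subseteq> tree.body T"
proof
  fix a assume "a \<in> tree.body T'"
  then obtain y where y: "y \<in> T'" "a \<in> cell y" by (auto simp: tree.body_def)
  then obtain x where x: "x \<in> T" "(x, y) \<in> E" using assms by auto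
  have "cell y \<subseteq> cell x" using E_prefix[OF x(2)] X_W assms(2) y by (intro cell_prefix) auto
  then show "a \<in> tree.body T" using x y by (auto simp: tree.body_def)
qed

lemma group_component:
  assumes y: "y \<in> X l" obtains x where "x \<in> X l" "g l y = tree.component x"
proof -
  obtain x where x: "x \<in> g l y" using H_nonempty[OF gH[OF y]] by blast
  then show ?thesis using that tree.component_unique[OF gH[OF y] x] gX[OF y] by blast
qed

lemma same_body_unique:
  assumes T: "T \<in> H" "T \<subseteq> X l" "T' \<in> H" "T' \<subseteq> X l" and p: "p \<in> tree.body T" "p \<in> tree.body T'"
  shows "T = T'"
proof (rule ccontr)
  assume ne: "T \<noteq> T'"
  obtain x x' where x: "x \<in> T" "x' \<in> T'" using H_nonempty[OF T(1)] H_nonempty[OF T(3)] by auto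
  have T_eq: "T = tree.component x" "T' = tree.component x'"
    using tree.component_unique[OF T(1) x(1)] tree.component_unique[OF T(3) x(2)] .
  have "\<kappa> * r ^ l < dist p p"
  proof (rule tree.bodies_apart[of x l x'])
    show "x \<in> level Aug l" "x' \<in> level Aug l" using x T by auto
    show "tree.component x \<noteq> tree.component x'" using ne unfolding T_eq[symmetric] .
    show "p \<in> tree.body (tree.component x)" "p \<in> tree.body (tree.component x')"
      using p unfolding T_eq[symmetric] .
  qed
  moreover have "0 < \<kappa> * r ^ l" using \<kappa>_pos r_bounds by simp
  ultimately show False by simp
qed

lemma piece_decreasing: assumes w: "w \<in> Codes" shows "piece w (Suc l) \<subseteq> piece w l"
proof -
  have "parent (node w (Suc l)) = node w l" by (rule parent_eq[OF node_E[OF w]])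
  moreover have "g (Suc l) (node w (Suc l)) \<subseteq> E `` g l (parent (node w (Suc l)))"
    by (rule refinesD(1)[OF g_ref node_in_X[OF w]])
  ultimately have "g (Suc l) (node w (Suc l)) \<subseteq> E `` g l (node w l)" by simp
  then show ?thesis using gX[OF node_in_X[OF w]] by (rule body_mono)
qed

text \<open>
  The bodies met along an end are decreasing and compact.
\<close>
lemma code_point: assumes w: "w \<in> Codes" shows "\<exists>p. \<forall>l. p \<in> piece w l"
proof -
  have c: "compact (piece w l) \<and> piece w l \<noteq> {}" for l
  proof -
    obtain x where "x \<in> X l" "g l (node w l) = tree.component x"
      using group_component[OF node_in_X[OF w]] .
    then show ?thesis using tree.compact_body[of x l] by simp
  qed
  have "piece w l' \<subseteq> piece w l" if "l \<le> l'" for l l'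
    using that by (induction rule: dec_induct) (use piece_decreasing[OF w] in blast)+
  then have "\<Inter>(range (piece w)) \<noteq> {}" using c by (intro compact_nest) auto
  then show ?thesis by auto
qed

text \<open>
  The components \<open>T l\<close> whose bodies contain \<open>p\<close> are nested.  The set of words assigned to \<open>T (Suc l)\<close> has a common
  parent \<open>v l\<close>, whichever word \<open>y (Suc l)\<close> of it is chosen, and these parents form a path.
\<close>
lemma point_code:
  assumes p: "p \<in> K" shows "\<exists>w\<in>Codes. \<forall>l. p \<in> piece w l"
proof -
  have "\<exists>T. T \<in> H \<and> T \<subseteq> X l \<and> p \<in> tree.body T" for l
  proof -
    obtain x where x: "x \<in> level Aug l" "p \<in> tree.body (tree.component x)" using tree.in_body[OF p] .
    have "tree.component x \<in> H" unfolding tree.components_iff using x(1) by blast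
    moreover have "tree.component x \<subseteq> X l" using tree.component_level[OF x(1)] by simp
    ultimately show ?thesis using x(2) by (intro exI[of _ "tree.component x"]) simp
  qed
  then have "\<forall>l. \<exists>T. T \<in> H \<and> T \<subseteq> X l \<and> p \<in> tree.body T" ..
  from choice[OF this] obtain T where T: "\<forall>l. T l \<in> H \<and> T l \<subseteq> X l \<and> p \<in> tree.body (T l)" ..
  have TE: "T (Suc l) \<subseteq> E `` T l" for l
  proof -
    have TS: "T (Suc l) \<in> H" "T (Suc l) \<subseteq> X (Suc l)" using T by auto
    obtain T' where T': "T' \<in> H" "T' \<subseteq> X l" "T (Suc l) \<subseteq> E `` T'"
      using ex_parent_component[OF TS] .
    have "p \<in> tree.body (T (Suc l))" using T by simp
    then have "p \<in> tree.body T'" by (rule subsetD[OF body_mono[OF T'(3) TS(2)]])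
    then have "T' = T l" using same_body_unique[OF T'(1,2), of "T l" p] T by simp
    then show ?thesis using T'(3) by simp
  qed
  have "\<forall>l. \<exists>y. y \<in> X l \<and> g l y = T l"
  proof
    fix l
    show "\<exists>y. y \<in> X l \<and> g l y = T l" using g_onto[of "T l" l] T by auto
  qed
  from choice[OF this] obtain y where y: "\<forall>l. y l \<in> X l \<and> g l (y l) = T l" ..
  define v where "v l = parent (y (Suc l))" for l
  have vX: "v l \<in> X l" for l unfolding v_def by (rule parent_level(1)) (use y in simp)
  have gv: "g l (v l) = T l" for l
  proof -
    have "T (Suc l) \<in> H" using T by simp
    then obtain z where z: "z \<in> T (Suc l)" using H_nonempty[of "T (Suc l)"] by auto
    have "g (Suc l) (y (Suc l)) \<subseteq> E `` g l (parent (y (Suc l)))"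
      by (rule refinesD(1)[OF g_ref]) (use y in simp)
    then have "z \<in> E `` g l (v l)" using z y by (simp add: v_def subset_iff)
    moreover have "z \<in> E `` T l" using TE z by (rule subsetD)
    moreover have "T l \<in> H" using T by simp
    ultimately show ?thesis by (intro parent_component_unique[OF gH[OF vX]])
  qed
  have "(v l, v (Suc l)) \<in> E" for l
  proof -
    have "parent (v (Suc l)) = parent (y (Suc l))"
      by (rule refinesD(2)[OF g_ref vX]) (use y gv in simp_all)
    then show ?thesis using parent_level(2)[OF vX[of "Suc l"]] by (simp add: v_def)
  qed
  from chain_to_code[of v, OF vX this] obtain w where w: "w \<in> Codes" "\<forall>l. node w l = v l" ..
  then have "p \<in> piece w l" for l using gv T by simp
  then show ?thesis using w(1) by blast
qed

text \<open>
  If the nodes of two words agree at level \<open>j\<close>, then the points lie in the same body, at distance \<open>O(r\<^sup>j)\<close>.  If the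
  nodes differ at level \<open>j + 1\<close>, then the bodies differ at level \<open>j + 2\<close> at the latest, because words assigned
  to the same component are siblings; this separates the points by more than \<open>\<kappa> * r ^ (j + 2)\<close>.
\<close>
lemma grouping_coding:
  assumes M: "\<And>T. T \<in> H \<Longrightarrow> card T \<le> M"
  shows "\<exists>f. tree_coding dist f \<and> f ` Codes = K"
proof -
  \<comment> \<open>The summand 1 makes \<open>C\<close> positive.\<close>
  define C where "C = diameter K + real (M * M) * (diameter K + \<kappa>) + 1"
  have C: "0 < C" using tree.D \<kappa>_pos unfolding C_def by (intro add_nonneg_pos add_nonneg_nonneg mult_nonneg_nonneg) auto
  have small: "dist a b \<le> C * r ^ l" if w: "w \<in> Codes" and ab: "a \<in> piece w l" "b \<in> piece w l" for w a b l
  proof -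
    obtain x where x: "x \<in> X l" "g l (node w l) = tree.component x"
      using group_component[OF node_in_X[OF w]] .
    have "dist a b \<le> (diameter K + real (M * M) * (diameter K + \<kappa>)) * r ^ l"
      by (rule tree.bodies_small[OF M]) (use x ab in simp_all)
    also have "\<dots> \<le> C * r ^ l" using r_bounds unfolding C_def by (intro mult_right_mono) auto
    finally show ?thesis .
  qed
  define f where "f w = (SOME p. \<forall>l. p \<in> piece w l)" for w
  have f: "f w \<in> piece w l" if "w \<in> Codes" for w l
    using someI_ex[OF code_point[OF that]] unfolding f_def by blast
  have onto: "f ` Codes = K"
  proof
    show "f ` Codes \<subseteq> K"
    proof
      fix p assume "p \<in> f ` Codes"
      then obtain w where w: "w \<in> Codes" "p = f w" by blast
      have "tree.body (g 0 (node w 0)) \<subseteq> K"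
        using gX[OF node_in_X[OF w(1), of 0]] cells_cover[of 0] unfolding tree.body_def by blast
      then show "p \<in> K" using f[OF w(1), of 0] w(2) by blast
    qed
    show "K \<subseteq> f ` Codes"
    proof
      fix p assume "p \<in> K"
      then obtain w where w: "w \<in> Codes" "\<forall>l. p \<in> piece w l" using point_code by blast
      have le: "dist p (f w) \<le> C * r ^ l" for l using small[OF w(1), of p l "f w"] w f by blast
      have "(\<lambda>l. C * r ^ l) \<longlonglongrightarrow> C * 0"
        using r_bounds by (intro tendsto_mult_left LIMSEQ_power_zero) auto
      then have "dist p (f w) \<le> C * 0"
        using le by (intro LIMSEQ_le_const[where X = "\<lambda>l. C * r ^ l"]) auto
      then show "p \<in> f ` Codes" using w(1) by auto
    qed
  qed
  have "\<kappa> * r\<^sup>2 * ratio_of (pre w l) \<le> dist (f w) (f w') \<and> dist (f w) (f w') \<le> C / r * ratio_of (pre w l)"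
    if w: "w \<in> Codes" "w' \<in> Codes" and l: "pre w l = pre w' l" "w l \<noteq> w' l" for w w' l
  proof -
    obtain j where j: "node w j = node w' j" "node w (Suc j) \<noteq> node w' (Suc j)"
      "r ^ Suc j < ratio_of (pre w l)" "ratio_of (pre w l) \<le> r ^ j"
      using node_split[OF w l] .
    have "f w' \<in> piece w j" using f[OF w(2), of j] j(1) by simp
    then have "dist (f w) (f w') \<le> C * r ^ j" using small[OF w(1) f[OF w(1)]] by blast
    also have "\<dots> = C / r * r ^ Suc j" using r_bounds by simp
    also have "\<dots> \<le> C / r * ratio_of (pre w l)" using j(3) C r_bounds by (intro mult_left_mono) auto
    finally have up: "dist (f w) (f w') \<le> C / r * ratio_of (pre w l)" .
    let ?k = "Suc (Suc j)"
    have par: "parent (node w ?k) = node w (Suc j)" "parent (node w' ?k) = node w' (Suc j)"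
      using parent_eq[OF node_E[OF w(1)]] parent_eq[OF node_E[OF w(2)]] by auto
    have ne: "g ?k (node w ?k) \<noteq> g ?k (node w' ?k)"
    proof
      assume "g ?k (node w ?k) = g ?k (node w' ?k)"
      then have "parent (node w ?k) = parent (node w' ?k)"
        by (rule refinesD(2)[OF g_ref node_in_X[OF w(1)] node_in_X[OF w(2)]])
      then show False using par j(2) by simp
    qed
    obtain x where x: "x \<in> X ?k" "g ?k (node w ?k) = tree.component x"
      using group_component[OF node_in_X[OF w(1)]] .
    obtain x' where x': "x' \<in> X ?k" "g ?k (node w' ?k) = tree.component x'"
      using group_component[OF node_in_X[OF w(2)]] .
    have "\<kappa> * r ^ ?k < dist (f w) (f w')"
      using f[OF w(1), of ?k] f[OF w(2), of ?k] ne x x'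
      by (intro tree.bodies_apart[of x ?k x']) simp_all
    moreover have "\<kappa> * r\<^sup>2 * ratio_of (pre w l) \<le> \<kappa> * r\<^sup>2 * r ^ j"
      using j(4) \<kappa>_pos r_bounds by (intro mult_left_mono) auto
    moreover have "\<kappa> * r\<^sup>2 * r ^ j = \<kappa> * r ^ ?k" by (simp add: power2_eq_square)
    ultimately show ?thesis using up by simp
  qed
  then have "tree_coding dist f"
    unfolding tree_coding_def using \<kappa>_pos r_bounds C
    by (intro exI[of _ "\<kappa> * r\<^sup>2"] conjI exI[of _ "C / r"]) simp_all
  then show ?thesis using onto by blast
qed

end

end

section \<open>Lipschitz equivalence\<close>

lemma lipschitz_equivalent_compact_space:
  assumes e: "lipschitz_equivalent m m'" and c: "compact_space (mtopology_of m)"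
  shows "compact_space (mtopology_of m')"
proof -
  obtain f C where bij: "bij_betw f (mspace m) (mspace m')"
    and C: "\<forall>x\<in>mspace m. \<forall>y\<in>mspace m. mdist m' (f x) (f y) \<le> C * mdist m x y"
    using e unfolding lipschitz_equivalent_def by blast
  have im: "f ` mspace m = mspace m'" using bij by (simp add: bij_betw_def)
  have "Lipschitz_continuous_map m m' f"
    unfolding Lipschitz_continuous_map_def using im C by auto
  then have "continuous_map (mtopology_of m) (mtopology_of m') f"
    by (intro uniformly_continuous_imp_continuous_map Lipschitz_imp_uniformly_continuous_map)
  then have "compactin (mtopology_of m') (f ` mspace m)"
    using c by (intro image_compactin) (auto simp: compact_space_def)
  then show ?thesis using im by (simp add: compact_space_def)
qed

lemma compact_space_euclidean_submetric:
  fixes K :: "'a::euclidean_space set"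
  shows "compact_space (mtopology_of (submetric euclidean_metric K)) \<longleftrightarrow> compact K"
  by (simp add: mtopology_of_submetric compact_space_subtopology compactin_subspace flip: compactin_euclidean_iff)

lemma similitude_system_of_ifs:
  fixes S :: "nat \<Rightarrow> 'a::euclidean_space \<Rightarrow> 'a"
  assumes ifs: "similitude_ifs euclidean_metric N \<rho> S"
    and K: "self_similar_set euclidean_metric N S K" and \<kappa>: "\<kappa> > 0"
  shows "similitude_system N \<rho> S K \<kappa>"
proof
  show "1 \<le> N" using ifs by (simp add: similitude_ifs_def)
  show "0 < \<rho> i \<and> \<rho> i < 1" "dist (S i a) (S i b) = \<rho> i * dist a b" if "i \<in> {1..N}" for i a b
    using ifs that by (auto simp: similitude_ifs_def contractive_similitude_def)
  note K' = K[unfolded self_similar_set_def mtopology_of_euclidean compactin_euclidean_iff]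
  show "K \<noteq> {}" by (rule conjunct1[OF K'])
  show "compact K" by (rule conjunct1[OF conjunct2[OF K']])
  show "K = (\<Union>i\<in>{1..N}. S i ` K)" by (rule conjunct2[OF conjunct2[OF K']])
  show "0 < \<kappa>" by (rule \<kappa>)
qed

context similitude_system
begin

lemma ex_coding:
  assumes \<tau>: "bij_betw \<tau> {1..m} (component_classes Aug)"
    and \<sigma>: "bij_betw \<sigma> {1..n} (vertex_classes (vertices Aug) E)"
    and A: "is_component_incidence Aug m \<tau> A" and B: "is_tree_incidence E n \<sigma> B"
    and u: "is_representation m \<tau> n \<sigma> u" and R: "rearrangeable m n B u A"
  shows "\<exists>f. tree_coding dist f \<and> f ` Codes = K"
proof -
  from bounded_components[OF \<tau> \<sigma> u] obtain M where M: "\<forall>T\<in>H. card T \<le> M" ..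
  from ex_grouping[OF assms] obtain g where
    g: "(\<forall>l. \<forall>y\<in>X l. g l y \<in> H \<and> g l y \<subseteq> X l) \<and>
      (\<forall>l. \<forall>T\<in>H. T \<subseteq> X l \<longrightarrow> (\<exists>y\<in>X l. g l y = T)) \<and> (\<forall>l. refines l (g l) (g (Suc l)))" ..
  show ?thesis
  proof (rule grouping_coding[of g])
    show "card T \<le> M" if "T \<in> H" for T using M that by simp
    show "refines l (g l) (g (Suc l))" for l using g by simp
  qed (use g in auto)
qed

text \<open>
  The dust-like set is compact because it is Lipschitz equivalent to \<open>K\<close>.
\<close>
lemma tree_imp_dust_like:
  assumes "bij_betw \<tau> {1..m} (component_classes Aug)"
    and "bij_betw \<sigma> {1..n} (vertex_classes (vertices Aug) (vert Aug))"
    and "is_component_incidence Aug m \<tau> A" and "is_tree_incidence (vert Aug) n \<sigma> B"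
    and "is_representation m \<tau> n \<sigma> u" and "rearrangeable m n B u A"
  shows "\<exists>d' S' K'. 1 \<le> d' \<and>
           similitude_ifs (euclidean_n_metric d') N \<rho> S' \<and>
           self_similar_set (euclidean_n_metric d') N S' K' \<and>
           dust_like N S' K' \<and>
           lipschitz_equivalent (submetric euclidean_metric K)
             (submetric (euclidean_n_metric d') K')"
proof -
  from ex_coding[OF assms[unfolded vert_aug]]
  obtain f where f: "tree_coding dist f" "f ` Codes = K" by (elim exE conjE) (rule that)
  obtain k t where kt: "0 < k" "0 < t" "t < 1" "\<And>i. i \<in> {1..N} \<Longrightarrow> \<rho> i \<le> t" "t ^ k * (2 * real N + 1) \<le> 1"
    by (rule dust_parameters) (rule that)
  let ?K' = "dust_point k ` Codes" and ?M = "euclidean_n_metric k"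
  have sub: "?K' \<subseteq> mspace ?M"
    by (auto simp: topspace_Euclidean_space dust_point_def)
  have md: "mdist ?M = (\<lambda>x y. L2_set (\<lambda>b. x b - y b) {..<k})" by (intro ext) simp
  have eqv: "lipschitz_equivalent (submetric euclidean_metric K) (submetric ?M ?K')"
  proof (rule lipschitz_equivalent_of_codings)
    have de: "mdist (submetric euclidean_metric K) = dist" by (intro ext) simp
    show "tree_coding (mdist (submetric euclidean_metric K)) f" unfolding de by (rule f(1))
    show "f ` Codes = mspace (submetric euclidean_metric K)" using f(2) by simp
    show "tree_coding (mdist (submetric ?M ?K')) (dust_point k)"
      using dust_coding[OF kt] md by simp
    show "?K' = mspace (submetric ?M ?K')" using sub by auto
  qed
  have "compact_space (mtopology_of (submetric ?M ?K'))"
    using lipschitz_equivalent_compact_space[OF eqv] compact_K compact_space_euclidean_submetric by blast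
  then have "compactin (mtopology_of ?M) ?K'"
    using sub by (simp add: mtopology_of_submetric compactin_subspace)
  moreover have "?K' \<noteq> {}" using f(2) K_ne by auto
  ultimately have "self_similar_set ?M N (dust_map k) ?K'"
    unfolding self_similar_set_def by (intro conjI dust_self_similar[OF kt])
  then show ?thesis
    using kt(1) dust_ifs[OF kt] dust_like_dust[OF kt] eqv
    by (intro exI[of _ k] exI[of _ "dust_map k"] exI[of _ ?K']) simp
qed

lemma cantor_type_K:
  assumes M: "\<And>T. T \<in> horizontal_components Quot \<Longrightarrow> card T \<le> M"
  shows "cantor_type (submetric euclidean_metric K)"
  unfolding cantor_type_def totally_disconnected_space_def
proof (intro conjI allI impI)
  show "compact_space (mtopology_of (submetric euclidean_metric K))"
    using compact_K by (simp add: compact_space_euclidean_submetric)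
  fix U assume "connectedin (mtopology_of (submetric euclidean_metric K)) U"
  then have "connected U" "U \<subseteq> K"
    by (auto simp: mtopology_of_submetric connectedin_subtopology)
  then show "\<exists>a. U \<subseteq> {a}" using quotient.connected_subset_singleton[OF M] by blast
qed

end

lemma lipschitz_equivalent_refl: "lipschitz_equivalent m m"
  unfolding lipschitz_equivalent_def by (intro exI[of _ id] exI[of _ 1]) simp

theorem theorem1p3:
  fixes S :: "nat \<Rightarrow> 'a::euclidean_space \<Rightarrow> 'a" and \<rho> :: "nat \<Rightarrow> real"
    and N :: nat and K :: "'a set" and \<kappa> :: real
  defines "X \<equiv> augmented_tree N \<rho> S K \<kappa>"
    and "Xq \<equiv> quotient_tree N \<rho> S K \<kappa>"
  assumes "similitude_ifs euclidean_metric N \<rho> S"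
    and "self_similar_set euclidean_metric N S K"
    and "\<kappa> > 0"
  shows
    "(\<forall>m n \<tau> \<sigma> A B u.
        simple_graph X \<and>
        bij_betw \<tau> {1..m} (component_classes X) \<and>
        bij_betw \<sigma> {1..n} (vertex_classes (vertices X) (vert X)) \<and> [] \<in> \<sigma> 1 \<and>
        is_component_incidence X m \<tau> A \<and>
        is_tree_incidence (vert X) n \<sigma> B \<and>
        is_representation m \<tau> n \<sigma> u \<and>
        rearrangeable m n B u A \<longrightarrow>
        (\<exists>d' S' K'. 1 \<le> d' \<and>
           similitude_ifs (euclidean_n_metric d') N \<rho> S' \<and>
           self_similar_set (euclidean_n_metric d') N S' K' \<and>
           dust_like N S' K' \<and>
           lipschitz_equivalent (submetric euclidean_metric K)
             (submetric (euclidean_n_metric d') K')))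
     \<and>
     (\<forall>m n \<tau> \<sigma> A B u.
        simple_graph Xq \<and>
        bij_betw \<tau> {1..m} (component_classes Xq) \<and>
        bij_betw \<sigma> {1..n} (vertex_classes (vertices Xq) (reduced_vert Xq)) \<and> {[]} \<in> \<sigma> 1 \<and>
        is_component_incidence Xq m \<tau> A \<and>
        is_tree_incidence (reduced_vert Xq) n \<sigma> B \<and>
        is_representation m \<tau> n \<sigma> u \<and>
        rearrangeable m n B u A \<longrightarrow>
        (\<exists>M :: 'a metric. cantor_type M \<and>
           lipschitz_equivalent (submetric euclidean_metric K) M))"
proof (intro conjI allI impI; elim conjE)
  have sys: "similitude_system N \<rho> S K \<kappa>"
    by (rule similitude_system_of_ifs) fact+
  {
    fix m n \<tau> \<sigma> A B u
    assume "bij_betw \<tau> {1..m} (component_classes X)"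
      "bij_betw \<sigma> {1..n} (vertex_classes (vertices X) (vert X))"
      "is_component_incidence X m \<tau> A" "is_tree_incidence (vert X) n \<sigma> B"
      "is_representation m \<tau> n \<sigma> u" "rearrangeable m n B u A"
    from similitude_system.tree_imp_dust_like[OF sys this[unfolded X_def]]
    show "\<exists>d' S' K'. 1 \<le> d' \<and>
           similitude_ifs (euclidean_n_metric d') N \<rho> S' \<and>
           self_similar_set (euclidean_n_metric d') N S' K' \<and>
           dust_like N S' K' \<and>
           lipschitz_equivalent (submetric euclidean_metric K)
             (submetric (euclidean_n_metric d') K')" .
  next
    fix m n \<tau> \<sigma> A B u
    assume "bij_betw \<tau> {1..m} (component_classes Xq)"
      "bij_betw \<sigma> {1..n} (vertex_classes (vertices Xq) (reduced_vert Xq))"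
      "is_representation m \<tau> n \<sigma> u"
    from bounded_components[OF this] obtain M where
      M: "\<forall>T\<in>horizontal_components Xq. card T \<le> M" ..
    have "cantor_type (submetric euclidean_metric K)"
      by (rule similitude_system.cantor_type_K[OF sys, where M = M]) (use M in \<open>simp add: Xq_def\<close>)
    then show "\<exists>M :: 'a metric. cantor_type M \<and>
           lipschitz_equivalent (submetric euclidean_metric K) M"
      using lipschitz_equivalent_refl by (intro exI[of _ "submetric euclidean_metric K"]) simp
  }
qed

end
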